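(* Let $m\ge 0$ be a fixed integer. For each $n\ge 1$ let $\{X_{n,i}:1\le i\le n+m\}$ be a temporally non-homogeneous Markov chain with values in a Borel space $\mathcal{X}$, let $f_{n,i}:\mathcal{X}^{1+m}\to\mathbb{R}$, $1\le i\le n$, be measurable functions, and set $$S_n=\sum_{i=1}^n Z_{n,i},\qquad Z_{n,i}=f_{n,i}(X_{n,i},\ldots,X_{n,i+m}).$$ Let $\alpha_n$ be the minimal ergodic coefficient of the $n$-th row. If there are constants $C_1,C_2,\ldots$ such that $$\max_{1\le i\le n}\|f_{n,i}\|_\infty\le C_n\qquad\text{and}\qquad C_n^2\alpha_n^{-2}=o(\operatorname{Var}[S_n])\quad\text{as } n\to\infty,$$ then one has the convergence in distribution $$\frac{S_n-\mathbb{E}[S_n]}{\sqrt{\operatorname{Var}[S_n]}}\Longrightarrow N(0,1)\qquad\text{as } n\to\infty.$$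
   Context: Temporally non-homogeneous Markov chain: for each $n$, the row $\{X_{n,i}:1\le i\le n+m\}$ is a Markov process determined by an arbitrary initial distribution of $X_{n,1}$ and by Markov transition kernels $K^{(n)}_{i,i+1}$ on $\mathcal{X}$, where $K^{(n)}_{i,i+1}(x,B)=\mathbb{P}(X_{n,i+1}\in B\mid X_{n,i}=x)$ for $x\in\mathcal{X}$ and $B\in\mathcal{B}(\mathcal{X})$ (the Borel sets of $\mathcal{X}$); the kernels may depend on $i$ and $n$. For a Markov transition kernel $K$ on $\mathcal{X}$, the Dobrushin contraction coefficient is $\delta(K)=\sup_{x_1,x_2\in\mathcal{X},\,B\in\mathcal{B}(\mathcal{X})}|K(x_1,B)-K(x_2,B)|$ and the ergodic coefficient is $\alpha(K)=1-\delta(K)$. The minimal ergodic coefficient of the $n$-th row is $\alpha_n=\min_{1\le i<n}\alpha(K^{(n)}_{i,i+1})$ (only the kernels with $1\le i<n$ enter; $\alpha_1=1$ by convention). $\|f\|_\infty$ is the supremum norm. The relation $C_n^2\alpha_n^{-2}=o(\operatorname{Var}[S_n])$ means that, for all large $n$, $\alpha_n>0$ and $\operatorname{Var}[S_n]>0$, and that $C_n^2\alpha_n^{-2}/\operatorname{Var}[S_n]\to 0$ as $n\to\infty$. *)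

theory Defs
  imports "HOL-Probability.Probability"
begin

text \<open>Throughout, \<open>S\<close> is the state space. A Borel space is represented as
  \<open>restrict_space borel E\<close> with \<open>E\<close> a Borel subset of a Polish space: its measurable sets are
  the Borel sets of the subspace \<open>E\<close>.\<close>

definition markov_kernel :: "'a measure \<Rightarrow> ('a \<Rightarrow> 'a measure) \<Rightarrow> bool" where
  "markov_kernel S K \<longleftrightarrow> K \<in> S \<rightarrow>\<^sub>M prob_algebra S"

definition past :: "'w measure \<Rightarrow> 'a measure \<Rightarrow> (nat \<Rightarrow> 'w \<Rightarrow> 'a) \<Rightarrow> nat \<Rightarrow> 'w measure" where
  "past P S X i =
     vimage_algebra (space P) (\<lambda>\<omega>. \<lambda>j\<in>{1..i}. X j \<omega>) (Pi\<^sub>M {1..i} (\<lambda>_. S))"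

text \<open>The chain has times \<open>1, \<dots>, N\<close> and \<open>K i\<close> is the kernel of the step from
  \<open>i\<close> to \<open>i + 1\<close>. The law of \<open>X 1\<close> is unconstrained.\<close>

definition markov_chain ::
  "'w measure \<Rightarrow> 'a measure \<Rightarrow> nat \<Rightarrow> (nat \<Rightarrow> 'a \<Rightarrow> 'a measure) \<Rightarrow> (nat \<Rightarrow> 'w \<Rightarrow> 'a) \<Rightarrow> bool" where
  "markov_chain P S N K X \<longleftrightarrow>
     prob_space P \<and>
     (\<forall>i\<in>{1..N}. X i \<in> P \<rightarrow>\<^sub>M S) \<and>
     (\<forall>i\<in>{1..<N}. markov_kernel S (K i)) \<and>
     (\<forall>i\<in>{1..<N}. \<forall>B\<in>sets S. AE \<omega> in P.
        real_cond_exp P (past P S X i) (\<lambda>\<omega>. indicator B (X (i + 1) \<omega>)) \<omega>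
          = measure (K i (X i \<omega>)) B)"

definition dobrushin_coeff :: "'a measure \<Rightarrow> ('a \<Rightarrow> 'a measure) \<Rightarrow> real" where
  "dobrushin_coeff S K =
     (SUP (x1, x2, B) \<in> space S \<times> space S \<times> sets S. \<bar>measure (K x1) B - measure (K x2) B\<bar>)"

definition ergodic_coeff :: "'a measure \<Rightarrow> ('a \<Rightarrow> 'a measure) \<Rightarrow> real" where
  "ergodic_coeff S K = 1 - dobrushin_coeff S K"

definition min_ergodic_coeff :: "'a measure \<Rightarrow> (nat \<Rightarrow> 'a \<Rightarrow> 'a measure) \<Rightarrow> nat \<Rightarrow> real" where
  "min_ergodic_coeff S K n =
     (if n \<le> 1 then 1 else (MIN i\<in>{1..<n}. ergodic_coeff S (K i)))"

text \<open>Extended-real valued, so that an unbounded function has norm \<open>\<infinity>\<close>.\<close>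

definition sup_norm_on :: "'b set \<Rightarrow> ('b \<Rightarrow> real) \<Rightarrow> ereal" where
  "sup_norm_on A g = (SUP x\<in>A. ereal \<bar>g x\<bar>)"

text \<open>Points of the \<open>(1 + m)\<close>-fold power of the state space are functions on \<open>{0..m}\<close>.\<close>

definition window :: "nat \<Rightarrow> (nat \<Rightarrow> 'w \<Rightarrow> 'a) \<Rightarrow> nat \<Rightarrow> 'w \<Rightarrow> (nat \<Rightarrow> 'a)" where
  "window m X i \<omega> = (\<lambda>j\<in>{0..m}. X (i + j) \<omega>)"

definition row_sum ::
  "nat \<Rightarrow> nat \<Rightarrow> (nat \<Rightarrow> (nat \<Rightarrow> 'a) \<Rightarrow> real) \<Rightarrow> (nat \<Rightarrow> 'w \<Rightarrow> 'a) \<Rightarrow> 'w \<Rightarrow> real" where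
  "row_sum m n f X \<omega> = (\<Sum>i=1..n. f i (window m X i \<omega>))"

end

theory Submission
  imports Defs
begin

text \<open>
  Let \<open>M\<^sub>k\<close> and \<open>W\<^sub>k\<close> be the conditional mean and variance of the normalized row sum given the
  path up to time \<open>k\<close>. The expectation of \<open>exp (\<i> t M\<^sub>k - t\<^sup>2 W\<^sub>k / 2)\<close> equals the Gaussian
  characteristic function at \<open>k = 0\<close> and that of the row sum at the last time, and a second order
  expansion shows that it hardly changes in between, provided that the increments of \<open>M\<close> and the
  oscillation of \<open>W\<^sub>k\<close> are of order \<open>\<epsilon>\<close> and \<open>\<epsilon>\<^sup>2\<close> with \<open>\<epsilon> = O (C / (\<alpha> \<sigma>))\<close>, where \<open>\<sigma>\<^sup>2\<close> is the
  variance of the row sum.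

  Both bounds come from backward recursions in which each step contracts oscillations by
  \<open>1 - \<alpha>\<close>. The conditional mean of the tail sum picks up \<open>O (C)\<close> per step, hence oscillates by
  \<open>O (C / \<alpha>)\<close>. Its conditional second moment picks up \<open>C\<close> times a conditional mean of the next
  tail, that is \<open>O (C\<^sup>2 / \<alpha>)\<close> per step, hence oscillates by \<open>O (C\<^sup>2 / \<alpha>\<^sup>2)\<close>. Bounding the
  conditional variance by a sum of squared martingale increments instead would cost a further
  factor \<open>1 / \<alpha>\<close>.
\<close>

subsection \<open>Bounded measurable functions\<close>

text \<open>As the conditional variance of the whole sum, the compensator \<open>W\<close> runs
  exactly from 1 to 0. Its concentration is drawn from its oscillation alone: the squared increments
  of \<open>W\<close> telescope against the squares of the means of \<open>W\<close>, up to an error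
  controlled by how far \<open>W_k\<close> strays from its mean.

  Oscillations are suprema over all paths. Conditional expectations are therefore integrals against
  explicit kernels on path space, where the tower and Markov properties hold at every point and not
  only almost everywhere. The given chain is linked to this model through the law of its trajectory.

  A summand looks \<open>m\<close> steps ahead, so at time \<open>k\<close> up to \<open>m\<close>
  summands are only partly revealed. The tail after \<open>k\<close> is kept apart from them: its
  conditional moments depend on at most the state at \<open>k\<close>, which is what lets a one-step
  contraction act. The partly revealed summands cost only factors depending on
  \<open>m\<close>.\<close>

definition bounded_measurable :: "'a measure \<Rightarrow> ('a \<Rightarrow> 'b::real_normed_vector) \<Rightarrow> bool" where
  "bounded_measurable M f \<longleftrightarrow> f \<in> borel_measurable M \<and> (\<exists>B. \<forall>x\<in>space M. norm (f x) \<le> B)"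

lemma bounded_measurableI:
  "f \<in> borel_measurable M \<Longrightarrow> (\<And>x. x \<in> space M \<Longrightarrow> norm (f x) \<le> B) \<Longrightarrow> bounded_measurable M f"
  unfolding bounded_measurable_def by blast

lemma bounded_measurableD: "bounded_measurable M f \<Longrightarrow> f \<in> borel_measurable M"
  unfolding bounded_measurable_def by blast

lemma bounded_measurable_const [simp, intro!]: "bounded_measurable M (\<lambda>_. c)"
  by (rule bounded_measurableI[of _ _ "norm c"]) auto

lemma bounded_measurable_add [intro!]:
  fixes f g :: "'a \<Rightarrow> 'b::{real_normed_vector, second_countable_topology}"
  assumes "bounded_measurable M f" "bounded_measurable M g"
  shows "bounded_measurable M (\<lambda>x. f x + g x)"
proof -
  obtain B C where "\<And>x. x \<in> space M \<Longrightarrow> norm (f x) \<le> B" "\<And>x. x \<in> space M \<Longrightarrow> norm (g x) \<le> C"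
    using assms unfolding bounded_measurable_def by blast
  then have "norm (f x + g x) \<le> B + C" if "x \<in> space M" for x
    using that norm_triangle_mono by blast
  then show ?thesis
    using assms by (intro bounded_measurableI) (auto dest!: bounded_measurableD)
qed

lemma bounded_measurable_mult [intro!]:
  fixes f g :: "'a \<Rightarrow> 'b::{real_normed_algebra, second_countable_topology}"
  assumes "bounded_measurable M f" "bounded_measurable M g"
  shows "bounded_measurable M (\<lambda>x. f x * g x)"
proof -
  obtain B C where BC: "\<And>x. x \<in> space M \<Longrightarrow> norm (f x) \<le> B" "\<And>x. x \<in> space M \<Longrightarrow> norm (g x) \<le> C"
    using assms unfolding bounded_measurable_def by blast
  have "norm (f x * g x) \<le> B * C" if "x \<in> space M" for x
  proof -
    have "norm (f x * g x) \<le> norm (f x) * norm (g x)" by (rule norm_mult_ineq)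
    also have "\<dots> \<le> B * C"
      using BC[OF that] by (intro mult_mono) (auto intro: order_trans[OF norm_ge_zero])
    finally show ?thesis .
  qed
  then show ?thesis
    using assms by (intro bounded_measurableI) (auto dest!: bounded_measurableD)
qed

lemma bounded_measurable_uminus [intro!]:
  fixes f :: "'a \<Rightarrow> 'b::{real_normed_vector, second_countable_topology}"
  assumes "bounded_measurable M f" shows "bounded_measurable M (\<lambda>x. - f x)"
  using assms unfolding bounded_measurable_def by auto

lemma bounded_measurable_diff [intro!]:
  fixes f g :: "'a \<Rightarrow> 'b::{real_normed_vector, second_countable_topology}"
  assumes "bounded_measurable M f" "bounded_measurable M g"
  shows "bounded_measurable M (\<lambda>x. f x - g x)"
  using bounded_measurable_add[OF assms(1) bounded_measurable_uminus[OF assms(2)]] by simp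

lemma bounded_measurable_sum [intro!]:
  fixes f :: "'i \<Rightarrow> 'a \<Rightarrow> 'b::{real_normed_vector, second_countable_topology}"
  assumes "\<And>i. i \<in> I \<Longrightarrow> bounded_measurable M (f i)"
  shows "bounded_measurable M (\<lambda>x. \<Sum>i\<in>I. f i x)"
  using assms by (induction I rule: infinite_finite_induct) auto

lemma bounded_measurable_power [intro!]:
  fixes f :: "'a \<Rightarrow> 'b::{real_normed_algebra_1, second_countable_topology}"
  assumes "bounded_measurable M f" shows "bounded_measurable M (\<lambda>x. f x ^ n)"
  by (induction n) (auto intro: assms)

lemma bounded_measurable_comp:
  assumes "bounded_measurable N f" "g \<in> M \<rightarrow>\<^sub>M N"
  shows "bounded_measurable M (\<lambda>x. f (g x))"
  using assms measurable_space[OF assms(2)] unfolding bounded_measurable_def by auto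

lemma bounded_measurable_Re [intro!]: "bounded_measurable M f \<Longrightarrow> bounded_measurable M (\<lambda>x. Re (f x))"
  and bounded_measurable_Im [intro!]: "bounded_measurable M f \<Longrightarrow> bounded_measurable M (\<lambda>x. Im (f x))"
  unfolding bounded_measurable_def
  by (auto intro: order_trans[OF abs_Re_le_cmod] order_trans[OF abs_Im_le_cmod])

lemma (in finite_measure) integrable_bounded_measurable:
  fixes f :: "'a \<Rightarrow> 'b::{banach, second_countable_topology}"
  assumes "bounded_measurable N f" "sets N = sets M"
  shows "integrable M f"
proof -
  obtain B where "\<And>x. x \<in> space N \<Longrightarrow> norm (f x) \<le> B"
    using assms unfolding bounded_measurable_def by blast
  moreover have "f \<in> borel_measurable M"
    using assms measurable_cong_sets by (auto dest: bounded_measurableD)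
  ultimately show ?thesis
    using sets_eq_imp_space_eq[OF assms(2)] by (intro integrable_const_bound[of _ B]) auto
qed

lemma (in prob_space) integral_norm_le_const:
  fixes f :: "'a \<Rightarrow> 'b::{banach, second_countable_topology}"
  assumes "\<And>x. x \<in> space M \<Longrightarrow> norm (f x) \<le> B"
  shows "norm (\<integral>x. f x \<partial>M) \<le> B"
proof (cases "integrable M f")
  case True
  have "norm (\<integral>x. f x \<partial>M) \<le> (\<integral>x. norm (f x) \<partial>M)" by (rule integral_norm_bound)
  also have "\<dots> \<le> (\<integral>x. B \<partial>M)"
    using True assms by (intro integral_mono) auto
  finally show ?thesis by (simp add: prob_space)
next
  case False
  \<comment> \<open>A non-integrable function has integral 0 by convention, so what remains is
    \<open>0 \<le> B\<close>.\<close>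
  obtain x where "x \<in> space M" using not_empty by blast
  then have "0 \<le> B" using assms norm_ge_zero order_trans by blast
  then show ?thesis using False by (simp add: not_integrable_integral_eq)
qed

lemma integral_bind_bounded_measurable:
  fixes f :: "'b \<Rightarrow> real"
  assumes "M \<in> space (prob_algebra A)" "k \<in> A \<rightarrow>\<^sub>M prob_algebra N" "bounded_measurable N f"
  shows "(\<integral>y. f y \<partial>(M \<bind> k)) = (\<integral>x. (\<integral>y. f y \<partial>k x) \<partial>M)"
proof -
  interpret prob_space M using assms by (simp add: space_prob_algebra)
  have sM: "sets M = sets A" using assms by (simp add: space_prob_algebra)
  obtain B where B: "\<And>x. x \<in> space N \<Longrightarrow> norm (f x) \<le> B"
    using assms unfolding bounded_measurable_def by blast
  have k: "k \<in> M \<rightarrow>\<^sub>M subprob_algebra N"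
    using measurable_prob_algebraD[OF assms(2)] measurable_cong_sets[OF sM refl] by blast
  show ?thesis
  proof (rule integral_bind[where K=N and B'=1])
    show "AE x in M. emeasure (k x) (space (k x)) \<le> ennreal 1"
      using measurable_space[OF k]
      by (intro AE_I2) (simp add: space_subprob_algebra subprob_space.emeasure_space_le_1)
  qed (use assms B k in \<open>auto dest: bounded_measurableD simp: finite_measure_axioms\<close>)
qed

subsection \<open>A compensated characteristic function\<close>

lemma exp_second_order:
  fixes z :: complex
  assumes "norm z \<le> 1"
  shows "norm (exp z - (1 + z + z\<^sup>2 / 2)) \<le> 2 * norm z ^ 3"
proof -
  have "norm (exp z - (\<Sum>i\<le>2. z ^ i / fact i)) \<le> exp (norm z) * (norm z ^ Suc 2) / fact 2"
    by (rule Taylor_exp_field)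
  moreover have "(\<Sum>i\<le>2. z ^ i / fact i) = 1 + z + z\<^sup>2 / 2"
    by (simp add: numeral_2_eq_2)
  \<comment> \<open>The crude bound 4 for \<open>exp 1\<close>, divided by \<open>fact 2\<close>, is
    the 2 of the claim.\<close>
  moreover have "exp (norm z) * norm z ^ 3 \<le> 4 * norm z ^ 3"
  proof (rule mult_right_mono)
    have "exp (norm z) \<le> exp 1" using assms by simp
    also have "\<dots> \<le> 4" using exp_le by simp
    finally show "exp (norm z) \<le> 4" .
  qed simp
  ultimately show ?thesis by (simp add: numeral_3_eq_3 numeral_2_eq_2)
qed

text \<open>With \<open>G\<close> counted as second order, the subtracted terms are exactly those of
  \<open>1 + z + z^2 / 2\<close> up to order two. The cross term in \<open>D * G\<close>, the term
  in \<open>G^2\<close> and the Taylor remainder are left over. They are expressed through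
  \<open>D^2\<close> and \<open>G^2\<close> because these can be summed over the time steps. The
  number \<open>q\<close> bounds the norm of the exponent.\<close>

lemma exp_compensated_expansion:
  fixes t D G e q :: real
  defines "q \<equiv> \<bar>t\<bar> * e + 3 / 2 * t\<^sup>2 * e\<^sup>2"
  assumes "e > 0" "\<bar>D\<bar> \<le> e" "\<bar>G\<bar> \<le> 3 * e\<^sup>2" "q \<le> 1"
  shows "norm (exp (\<i> * of_real (t * D) + of_real (t\<^sup>2 * G / 2)) - 1
            - (\<i> * of_real (t * D) + of_real (t\<^sup>2 * (G - D\<^sup>2) / 2)))
         \<le> (\<bar>t\<bar> ^ 3 * e / 4 + 4 * q * t\<^sup>2) * D\<^sup>2 + (\<bar>t\<bar> ^ 3 / (4 * e) + t ^ 4 / 8 + q * t ^ 4) * G\<^sup>2"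
proof -
  define z where "z = \<i> * complex_of_real (t * D) + of_real (t\<^sup>2 * G / 2)"
  have nz: "norm z \<le> \<bar>t\<bar> * \<bar>D\<bar> + t\<^sup>2 * \<bar>G\<bar> / 2"
    unfolding z_def by (rule order_trans[OF norm_triangle_ineq]) (simp add: norm_mult abs_mult norm_power)
  also have "\<dots> \<le> \<bar>t\<bar> * e + t\<^sup>2 * (3 * e\<^sup>2) / 2"
    using assms by (intro add_mono mult_left_mono divide_right_mono) auto
  finally have zq: "norm z \<le> q" by (simp add: q_def)
  have z2: "(norm z)\<^sup>2 \<le> 2 * t\<^sup>2 * D\<^sup>2 + t ^ 4 * G\<^sup>2 / 2"
  proof -
    have "(norm z)\<^sup>2 = (t * D)\<^sup>2 + (t\<^sup>2 * G / 2)\<^sup>2"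
      unfolding z_def cmod_power2 by simp
    also have "\<dots> = t\<^sup>2 * D\<^sup>2 + t ^ 4 * G\<^sup>2 / 4"
      by (simp add: power_mult_distrib power_divide flip: power_mult)
    also have "\<dots> \<le> 2 * t\<^sup>2 * D\<^sup>2 + t ^ 4 * G\<^sup>2 / 2"
      by (intro add_mono) (auto simp: divide_le_eq)
    finally show ?thesis .
  qed
  have "norm (exp z - (1 + z + z\<^sup>2 / 2)) \<le> 2 * (norm z * (norm z)\<^sup>2)"
    using exp_second_order[of z] zq assms by (simp add: power3_eq_cube power2_eq_square)
  also have "\<dots> \<le> 2 * (q * (2 * t\<^sup>2 * D\<^sup>2 + t ^ 4 * G\<^sup>2 / 2))"
    using zq z2 by (intro mult_left_mono mult_mono) (auto intro: order_trans[OF norm_ge_zero zq])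
  finally have 1: "norm (exp z - (1 + z + z\<^sup>2 / 2)) \<le> 4 * q * t\<^sup>2 * D\<^sup>2 + q * t ^ 4 * G\<^sup>2"
    by (simp add: algebra_simps)
  have z2_eq: "z\<^sup>2 / 2 = of_real (- (t\<^sup>2 * D\<^sup>2 / 2)) + (\<i> * of_real (t ^ 3 * (D * G) / 2) + of_real (t ^ 4 * G\<^sup>2 / 8))"
    unfolding z_def
    by (simp add: complex_eq_iff power2_eq_square power3_eq_cube power4_eq_xxxx field_simps)
  have "exp z - 1 - (\<i> * of_real (t * D) + of_real (t\<^sup>2 * (G - D\<^sup>2) / 2))
     = (exp z - (1 + z + z\<^sup>2 / 2)) + (\<i> * of_real (t ^ 3 * (D * G) / 2) + of_real (t ^ 4 * G\<^sup>2 / 8))"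
    unfolding z2_eq unfolding z_def by (simp add: algebra_simps diff_divide_distrib)
  also have "norm \<dots> \<le> (4 * q * t\<^sup>2 * D\<^sup>2 + q * t ^ 4 * G\<^sup>2) + (\<bar>t\<bar> ^ 3 * \<bar>D * G\<bar> / 2 + t ^ 4 * G\<^sup>2 / 8)"
  proof (rule norm_triangle_mono[OF 1])
    have "norm (\<i> * complex_of_real (t ^ 3 * (D * G) / 2)) = \<bar>t\<bar> ^ 3 * \<bar>D * G\<bar> / 2"
      unfolding norm_mult norm_of_real by (simp add: abs_mult power_abs)
    moreover have "norm (complex_of_real (t ^ 4 * G\<^sup>2 / 8)) = t ^ 4 * G\<^sup>2 / 8"
      unfolding norm_of_real by simp
    ultimately show "norm (\<i> * complex_of_real (t ^ 3 * (D * G) / 2) + complex_of_real (t ^ 4 * G\<^sup>2 / 8))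
        \<le> \<bar>t\<bar> ^ 3 * \<bar>D * G\<bar> / 2 + t ^ 4 * G\<^sup>2 / 8"
      by (metis norm_triangle_ineq)
  qed
  \<comment> \<open>The inequality between geometric and arithmetic mean, weighted by
    \<open>e\<close>. Summed over time, the means of \<open>D^2\<close> amount to at most 1 and
    those of \<open>G^2\<close> to at most \<open>3 * e^2\<close>, so with this weight both halves
    contribute order \<open>e\<close>.\<close>
  also have "\<bar>t\<bar> ^ 3 * \<bar>D * G\<bar> / 2 \<le> \<bar>t\<bar> ^ 3 * (e * D\<^sup>2 / 2 + G\<^sup>2 / (2 * e)) / 2"
  proof (intro divide_right_mono mult_left_mono)
    have "0 \<le> (e * \<bar>D\<bar> - \<bar>G\<bar>)\<^sup>2" by simp
    then have "2 * e * \<bar>D * G\<bar> \<le> e\<^sup>2 * D\<^sup>2 + G\<^sup>2"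
      by (simp add: power2_diff power_mult_distrib abs_mult)
    then show "\<bar>D * G\<bar> \<le> e * D\<^sup>2 / 2 + G\<^sup>2 / (2 * e)"
      using \<open>e > 0\<close> by (simp add: field_simps power2_eq_square)
  qed auto
  finally show ?thesis
    unfolding z_def using \<open>e > 0\<close> by (simp add: algebra_simps add_divide_distrib)
qed

text \<open>Here \<open>D\<close> is to be a martingale increment and \<open>G\<close> the drop of
  the conditional variance. Then \<open>D0\<close> removes the first-order term and
  \<open>DG\<close> the second-order one, which is the purpose of the compensator.\<close>

lemma (in prob_space) compensated_exp_expectation:
  fixes D G :: "'a \<Rightarrow> real" and t e :: real
  defines "q \<equiv> \<bar>t\<bar> * e + 3 / 2 * t\<^sup>2 * e\<^sup>2"
  assumes D: "bounded_measurable M D" and G: "bounded_measurable M G"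
    and e: "e > 0" and q: "q \<le> 1"
    and Db: "AE x in M. \<bar>D x\<bar> \<le> e" and Gb: "AE x in M. \<bar>G x\<bar> \<le> 3 * e\<^sup>2"
    and D0: "(\<integral>x. D x \<partial>M) = 0" and DG: "(\<integral>x. G x \<partial>M) = (\<integral>x. (D x)\<^sup>2 \<partial>M)"
  shows "norm ((\<integral>x. exp (\<i> * of_real (t * D x) + of_real (t\<^sup>2 * G x / 2)) \<partial>M) - 1)
     \<le> (\<bar>t\<bar> ^ 3 * e / 4 + 4 * q * t\<^sup>2) * (\<integral>x. (D x)\<^sup>2 \<partial>M)
       + (\<bar>t\<bar> ^ 3 / (4 * e) + t ^ 4 / 8 + q * t ^ 4) * (\<integral>x. (G x)\<^sup>2 \<partial>M)"
proof -
  note integ = integrable_bounded_measurable[OF _ refl]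
  note [measurable] = D[THEN bounded_measurableD] G[THEN bounded_measurableD]
  let ?E = "\<lambda>x. exp (\<i> * complex_of_real (t * D x) + of_real (t\<^sup>2 * G x / 2))"
  let ?L = "\<lambda>x. \<i> * complex_of_real (t * D x) + of_real (t\<^sup>2 * (G x - (D x)\<^sup>2) / 2)"
  have iD: "integrable M D" "integrable M G" "integrable M (\<lambda>x. (D x)\<^sup>2)" "integrable M (\<lambda>x. (G x)\<^sup>2)"
    using D G by (auto intro!: integ)
  have iE: "integrable M ?E"
  proof -
    have "AE x in M. norm (?E x) \<le> exp (t\<^sup>2 * (3 * e\<^sup>2) / 2)"
      using Gb by eventually_elim (auto intro!: mult_left_mono)
    then show ?thesis by (rule integrable_const_bound) measurable
  qed
  have L1: "integrable M (\<lambda>x. \<i> * complex_of_real (t * D x))"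
    using iD by (intro integrable_mult_right integrable_of_real) auto
  have L2: "integrable M (\<lambda>x. complex_of_real (t\<^sup>2 * (G x - (D x)\<^sup>2) / 2))"
    using iD by (intro integrable_of_real) auto
  have L0: "(\<integral>x. ?L x \<partial>M) = 0"
  proof -
    have 1: "(\<integral>x. complex_of_real (t\<^sup>2 * (G x - (D x)\<^sup>2) / 2) \<partial>M) = 0"
      unfolding integral_complex_of_real using iD DG by simp
    have 2: "(\<integral>x. \<i> * complex_of_real (t * D x) \<partial>M) = 0"
      using iD D0 by simp
    show ?thesis unfolding Bochner_Integration.integral_add[OF L1 L2] 1 2 by simp
  qed
  have eq: "(\<integral>x. ?E x \<partial>M) - 1 = (\<integral>x. ?E x - 1 - ?L x \<partial>M)"
  proof -
    have i1: "integrable M (\<lambda>x. ?E x - 1)" using iE by simp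
    have "(\<integral>x. ?E x - 1 - ?L x \<partial>M) = (\<integral>x. ?E x - 1 \<partial>M) - (\<integral>x. ?L x \<partial>M)"
      by (rule Bochner_Integration.integral_diff[OF i1 Bochner_Integration.integrable_add[OF L1 L2]])
    also have "\<dots> = (\<integral>x. ?E x - 1 \<partial>M)"
      unfolding L0 by (rule diff_zero)
    also have "\<dots> = (\<integral>x. ?E x \<partial>M) - (\<integral>x. 1 \<partial>M)"
      by (rule Bochner_Integration.integral_diff[OF iE]) simp
    finally show ?thesis by (simp only: lebesgue_integral_const prob_space scaleR_one)
  qed
  have "norm ((\<integral>x. ?E x \<partial>M) - 1) \<le> (\<integral>x. norm (?E x - 1 - ?L x) \<partial>M)"
    unfolding eq by (rule integral_norm_bound)
  also have "\<dots> \<le> (\<integral>x. (\<bar>t\<bar> ^ 3 * e / 4 + 4 * q * t\<^sup>2) * (D x)\<^sup>2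
       + (\<bar>t\<bar> ^ 3 / (4 * e) + t ^ 4 / 8 + q * t ^ 4) * (G x)\<^sup>2 \<partial>M)"
  proof (rule integral_mono_AE)
    show "AE x in M. norm (?E x - 1 - ?L x) \<le> (\<bar>t\<bar> ^ 3 * e / 4 + 4 * q * t\<^sup>2) * (D x)\<^sup>2
       + (\<bar>t\<bar> ^ 3 / (4 * e) + t ^ 4 / 8 + q * t ^ 4) * (G x)\<^sup>2"
      using Db Gb
    proof eventually_elim
      case (elim x)
      show ?case
        unfolding q_def by (rule exp_compensated_expansion[OF e elim q[unfolded q_def]])
    qed
    show "integrable M (\<lambda>x. norm (?E x - 1 - ?L x))"
      by (intro integrable_norm Bochner_Integration.integrable_diff iE Bochner_Integration.integrable_add L1 L2) simp
  qed (use iD in simp)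
  also have "\<dots> = (\<bar>t\<bar> ^ 3 * e / 4 + 4 * q * t\<^sup>2) * (\<integral>x. (D x)\<^sup>2 \<partial>M)
       + (\<bar>t\<bar> ^ 3 / (4 * e) + t ^ 4 / 8 + q * t ^ 4) * (\<integral>x. (G x)\<^sup>2 \<partial>M)"
    using iD by simp
  finally show ?thesis .
qed

text \<open>A filtration presented by regular conditional laws: \<open>Q k x\<close> is the law of
  the full path given what \<open>x\<close> reveals up to time \<open>k\<close>. The composition
  rule and the degenerate last kernel hold at every point. They are required for real functions
  because a locale assumption cannot be polymorphic; complex functions follow through real and
  imaginary parts.\<close>

locale conditional_kernels =
  fixes \<Omega> :: "'a measure" and Q :: "nat \<Rightarrow> 'a \<Rightarrow> 'a measure" and N :: nat
  assumes kernel: "k \<le> N \<Longrightarrow> Q k \<in> \<Omega> \<rightarrow>\<^sub>M prob_algebra \<Omega>"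
    and tower_real: "k \<le> l \<Longrightarrow> l \<le> N \<Longrightarrow> x \<in> space \<Omega> \<Longrightarrow> bounded_measurable \<Omega> (H :: 'a \<Rightarrow> real) \<Longrightarrow>
        (\<integral>y. (\<integral>z. H z \<partial>Q l y) \<partial>Q k x) = (\<integral>z. H z \<partial>Q k x)"
    and terminal_real: "x \<in> space \<Omega> \<Longrightarrow> bounded_measurable \<Omega> (H :: 'a \<Rightarrow> real) \<Longrightarrow>
        (\<integral>z. H z \<partial>Q N x) = H x"
begin

definition cexp :: "nat \<Rightarrow> ('a \<Rightarrow> 'b::{banach, second_countable_topology}) \<Rightarrow> 'a \<Rightarrow> 'b" where
  "cexp k H x = (\<integral>z. H z \<partial>Q k x)"

lemma prob_space_Q: "k \<le> N \<Longrightarrow> x \<in> space \<Omega> \<Longrightarrow> prob_space (Q k x)"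
  and sets_Q: "k \<le> N \<Longrightarrow> x \<in> space \<Omega> \<Longrightarrow> sets (Q k x) = sets \<Omega>"
  using measurable_space[OF kernel] by (auto simp: space_prob_algebra)

lemma space_Q: "k \<le> N \<Longrightarrow> x \<in> space \<Omega> \<Longrightarrow> space (Q k x) = space \<Omega>"
  using sets_Q sets_eq_imp_space_eq by blast

lemma integrable_Q:
  fixes H :: "'a \<Rightarrow> 'b::{banach, second_countable_topology}"
  assumes "k \<le> N" "x \<in> space \<Omega>" "bounded_measurable \<Omega> H"
  shows "integrable (Q k x) H"
proof -
  interpret prob_space "Q k x" using assms prob_space_Q by blast
  show ?thesis using integrable_bounded_measurable[OF assms(3)] sets_Q assms by metis
qed

lemma bounded_measurable_Q:
  assumes "k \<le> N" "x \<in> space \<Omega>" "bounded_measurable \<Omega> H"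
  shows "bounded_measurable (Q k x) H"
  using assms(3) sets_Q[OF assms(1,2)] space_Q[OF assms(1,2)]
  unfolding bounded_measurable_def by (auto cong: measurable_cong_sets)

lemma cexp_bound:
  assumes "k \<le> N" "x \<in> space \<Omega>" "\<And>y. y \<in> space \<Omega> \<Longrightarrow> norm (H y) \<le> B"
  shows "norm (cexp k H x) \<le> B"
proof -
  interpret prob_space "Q k x" using assms prob_space_Q by blast
  show ?thesis unfolding cexp_def
    by (rule integral_norm_le_const) (use assms space_Q in auto)
qed

lemma bounded_measurable_cexp [intro!]:
  assumes "k \<le> N" "bounded_measurable \<Omega> H"
  shows "bounded_measurable \<Omega> (cexp k H)"
proof -
  obtain B where B: "\<And>x. x \<in> space \<Omega> \<Longrightarrow> norm (H x) \<le> B"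
    using assms unfolding bounded_measurable_def by blast
  have "(\<lambda>x. \<integral>z. H z \<partial>Q k x) \<in> borel_measurable \<Omega>"
    by (rule measurable_compose[OF measurable_prob_algebraD[OF kernel[OF assms(1)]]
          integral_measurable_subprob_algebra[OF bounded_measurableD[OF assms(2)]]])
  then have "cexp k H \<in> borel_measurable \<Omega>" by (simp add: cexp_def[abs_def])
  then show ?thesis by (rule bounded_measurableI) (use assms B cexp_bound in blast)
qed

section \<open>Linearity, monotonicity and second moments of conditional expectations\<close>

context
  fixes k x assumes kx: "k \<le> N" "x \<in> space \<Omega>"
begin

lemma cexp_const: "cexp k (\<lambda>_. c) x = c"
  using prob_space.prob_space[OF prob_space_Q[OF kx]] by (simp add: cexp_def)

lemma cexp_add:
  assumes "bounded_measurable \<Omega> F" "bounded_measurable \<Omega> G"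
  shows "cexp k (\<lambda>y. F y + G y) x = cexp k F x + cexp k G x"
  unfolding cexp_def by (intro Bochner_Integration.integral_add integrable_Q kx assms)

lemma cexp_diff:
  assumes "bounded_measurable \<Omega> F" "bounded_measurable \<Omega> G"
  shows "cexp k (\<lambda>y. F y - G y) x = cexp k F x - cexp k G x"
  unfolding cexp_def by (intro Bochner_Integration.integral_diff integrable_Q kx assms)

lemma cexp_sum:
  assumes "\<And>i. i \<in> I \<Longrightarrow> bounded_measurable \<Omega> (F i)"
  shows "cexp k (\<lambda>y. \<Sum>i\<in>I. F i y) x = (\<Sum>i\<in>I. cexp k (F i) x)"
  unfolding cexp_def by (intro Bochner_Integration.integral_sum integrable_Q kx assms)

lemma cexp_cmult:
  fixes F :: "'a \<Rightarrow> 'b::{banach, second_countable_topology, real_normed_field}"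
  shows "cexp k (\<lambda>y. c * F y) x = c * cexp k F x"
  unfolding cexp_def by simp

lemma cexp_cong:
  assumes "\<And>y. y \<in> space \<Omega> \<Longrightarrow> F y = G y"
  shows "cexp k F x = cexp k G x"
  unfolding cexp_def by (rule Bochner_Integration.integral_cong) (use assms space_Q kx in auto)

lemma cexp_mono:
  fixes F G :: "'a \<Rightarrow> real"
  assumes "bounded_measurable \<Omega> F" "bounded_measurable \<Omega> G" "\<And>y. y \<in> space \<Omega> \<Longrightarrow> F y \<le> G y"
  shows "cexp k F x \<le> cexp k G x"
  unfolding cexp_def by (intro integral_mono integrable_Q kx assms) (use assms space_Q kx in auto)

lemma cexp_nonneg:
  fixes F :: "'a \<Rightarrow> real"
  assumes "\<And>y. y \<in> space \<Omega> \<Longrightarrow> 0 \<le> F y"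
  shows "0 \<le> cexp k F x"
  unfolding cexp_def by (intro integral_nonneg_AE AE_I2) (use assms space_Q kx in auto)

lemma cexp_variance:
  fixes F :: "'a \<Rightarrow> real"
  assumes "bounded_measurable \<Omega> F"
  shows "cexp k (\<lambda>y. (F y - c)\<^sup>2) x = cexp k (\<lambda>y. (F y)\<^sup>2) x - 2 * c * cexp k F x + c\<^sup>2"
proof -
  have bm: "bounded_measurable \<Omega> (\<lambda>y. (F y)\<^sup>2)" "bounded_measurable \<Omega> (\<lambda>y. 2 * c * F y)"
    using assms by auto
  have "cexp k (\<lambda>y. (F y - c)\<^sup>2) x = cexp k (\<lambda>y. ((F y)\<^sup>2 - 2 * c * F y) + c\<^sup>2) x"
    by (rule cexp_cong) (simp add: power2_diff)
  also have "\<dots> = cexp k (\<lambda>y. (F y)\<^sup>2) x - 2 * c * cexp k F x + c\<^sup>2"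
    using bm by (simp add: cexp_add cexp_diff cexp_cmult cexp_const bounded_measurable_diff)
  finally show ?thesis .
qed

lemma cexp_square_le:
  fixes F :: "'a \<Rightarrow> real"
  assumes "bounded_measurable \<Omega> F"
  shows "(cexp k F x)\<^sup>2 \<le> cexp k (\<lambda>y. (F y)\<^sup>2) x"
  using cexp_nonneg[of "\<lambda>y. (F y - cexp k F x)\<^sup>2"] cexp_variance[OF assms, of "cexp k F x"]
  by (simp add: power2_eq_square)

end

lemma tower:
  fixes H :: "'a \<Rightarrow> real"
  assumes "k \<le> l" "l \<le> N" "x \<in> space \<Omega>" "bounded_measurable \<Omega> H"
  shows "cexp k (cexp l H) x = cexp k H x"
  using tower_real[OF assms] by (simp add: cexp_def cexp_def[abs_def])

lemma terminal:
  fixes H :: "'a \<Rightarrow> real"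
  assumes "x \<in> space \<Omega>" "bounded_measurable \<Omega> H"
  shows "cexp N H x = H x"
  using terminal_real[OF assms] by (simp add: cexp_def)

lemma cexp_complex:
  assumes "k \<le> N" "x \<in> space \<Omega>" "bounded_measurable \<Omega> H"
  shows "Re (cexp k H x) = cexp k (\<lambda>y. Re (H y)) x" "Im (cexp k H x) = cexp k (\<lambda>y. Im (H y)) x"
  using integrable_Q[OF assms] by (simp_all add: cexp_def)

lemma tower_complex:
  fixes H :: "'a \<Rightarrow> complex"
  assumes "k \<le> l" "l \<le> N" "x \<in> space \<Omega>" "bounded_measurable \<Omega> H"
  shows "cexp k (cexp l H) x = cexp k H x"
proof (rule complex_eqI)
  have k: "k \<le> N" using assms by simp
  note bm = bounded_measurable_cexp[OF assms(2,4)]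
  have "Re (cexp k (cexp l H) x) = cexp k (cexp l (\<lambda>y. Re (H y))) x"
    using cexp_complex(1)[OF assms(2) _ assms(4)] by (subst cexp_complex(1)[OF k assms(3) bm]) (auto intro!: cexp_cong k assms)
  then show "Re (cexp k (cexp l H) x) = Re (cexp k H x)"
    using tower[OF assms(1-3) bounded_measurable_Re[OF assms(4)]] cexp_complex(1)[OF k assms(3,4)] by simp
  have "Im (cexp k (cexp l H) x) = cexp k (cexp l (\<lambda>y. Im (H y))) x"
    using cexp_complex(2)[OF assms(2) _ assms(4)] by (subst cexp_complex(2)[OF k assms(3) bm]) (auto intro!: cexp_cong k assms)
  then show "Im (cexp k (cexp l H) x) = Im (cexp k H x)"
    using tower[OF assms(1-3) bounded_measurable_Im[OF assms(4)]] cexp_complex(2)[OF k assms(3,4)] by simp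
qed

definition cvar :: "nat \<Rightarrow> ('a \<Rightarrow> real) \<Rightarrow> 'a \<Rightarrow> real" where
  "cvar k H x = cexp k (\<lambda>y. (H y)\<^sup>2) x - (cexp k H x)\<^sup>2"

text \<open>The error made when \<open>exp (\<i> t M\<^sub>k - t\<^sup>2 W\<^sub>k / 2)\<close>, with \<open>M\<^sub>k\<close> the conditional mean and \<open>W\<^sub>k\<close> the
  conditional variance of \<open>H\<close>, is treated as a martingale is controlled by the quadratic variations
  of \<open>M\<close> and of \<open>W\<close>. The latter is small because \<open>W\<close> is nearly deterministic.\<close>

theorem char_near_gaussian:
  fixes H :: "'a \<Rightarrow> real" and t e :: real
  defines "q \<equiv> \<bar>t\<bar> * e + 3 / 2 * t\<^sup>2 * e\<^sup>2"
  assumes H: "bounded_measurable \<Omega> H" and x0: "x0 \<in> space \<Omega>"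
    and e: "e > 0" and q: "q \<le> 1"
    and mean: "\<And>x. x \<in> space \<Omega> \<Longrightarrow> cexp 0 H x = 0"
    and var: "\<And>x. x \<in> space \<Omega> \<Longrightarrow> cexp 0 (\<lambda>y. (H y)\<^sup>2) x = 1"
    and incr: "\<And>k x. k < N \<Longrightarrow> x \<in> space \<Omega> \<Longrightarrow>
        AE y in Q k x. \<bar>cexp (Suc k) H y - cexp k H x\<bar> \<le> e"
    and osc: "\<And>k x y. k \<le> N \<Longrightarrow> x \<in> space \<Omega> \<Longrightarrow> y \<in> space \<Omega> \<Longrightarrow> \<bar>cvar k H x - cvar k H y\<bar> \<le> e\<^sup>2"
  shows "norm (cexp 0 (\<lambda>y. exp (\<i> * of_real (t * H y))) x0 - of_real (exp (- t\<^sup>2 / 2)))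
    \<le> (\<bar>t\<bar> ^ 3 * e / 4 + 4 * q * t\<^sup>2) + (\<bar>t\<bar> ^ 3 / (4 * e) + t ^ 4 / 8 + q * t ^ 4) * (3 * e\<^sup>2)"
proof -
  define M where "M k = cexp k H" for k
  define W where "W k = cvar k H" for k
  \<comment> \<open>A deterministic stand-in for the random \<open>W k\<close>, within
    \<open>e^2\<close> of it at every point by \<open>osc\<close>.\<close>
  define w where "w k = cexp 0 (W k) x0" for k
  define c1 where "c1 = \<bar>t\<bar> ^ 3 * e / 4 + 4 * q * t\<^sup>2"
  define c2 where "c2 = \<bar>t\<bar> ^ 3 / (4 * e) + t ^ 4 / 8 + q * t ^ 4"
  have q0: "0 \<le> q" using e unfolding q_def by simp
  have c: "0 \<le> c1" "0 \<le> c2" using e q0 by (auto simp: c1_def c2_def)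
  have H2: "bounded_measurable \<Omega> (\<lambda>y. (H y)\<^sup>2)" using H by auto
  have bM: "bounded_measurable \<Omega> (M k)" if "k \<le> N" for k
    using that H by (auto simp: M_def)
  have bW: "bounded_measurable \<Omega> (W k)" if "k \<le> N" for k
    unfolding W_def cvar_def[abs_def]
    by (intro bounded_measurable_diff bounded_measurable_power bounded_measurable_cexp that H)
  have Wnn: "0 \<le> W k x" if "k \<le> N" "x \<in> space \<Omega>" for k x
    using cexp_square_le[OF that H] by (simp add: W_def cvar_def)
  have WN: "W N x = 0" if "x \<in> space \<Omega>" for x
    using that terminal[OF that H] terminal[OF that H2] by (simp add: W_def cvar_def)
  have W0: "W 0 x = 1" if "x \<in> space \<Omega>" for x
    using mean var that by (simp add: W_def cvar_def)
  have Ww: "\<bar>W k x - w k\<bar> \<le> e\<^sup>2" if k: "k \<le> N" and x: "x \<in> space \<Omega>" for k x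
  proof -
    have eq: "w k - W k x = cexp 0 (\<lambda>y. W k y - W k x) x0"
      using bW[OF k] x0 by (simp add: w_def cexp_diff cexp_const)
    have "norm (w k - W k x) \<le> e\<^sup>2"
      unfolding eq by (rule cexp_bound) (use x0 osc[OF k _ x] W_def in auto)
    then show ?thesis by (simp add: abs_minus_commute)
  qed
  \<comment> \<open>Both sides are the conditional second moment of \<open>H\<close>, so
    \<open>M^2 + W\<close> is a martingale.\<close>
  have sqM: "cexp k (\<lambda>y. (M (Suc k) y)\<^sup>2 + W (Suc k) y) x = (M k x)\<^sup>2 + W k x"
    if "k < N" "x \<in> space \<Omega>" for k x
    using that tower[of k "Suc k" x "\<lambda>y. (H y)\<^sup>2"] H2
    by (simp add: M_def W_def cvar_def[abs_def])
  have MM: "cexp k (M (Suc k)) x = M k x" if "k < N" "x \<in> space \<Omega>" for k x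
    using that H by (simp add: M_def tower)
  \<comment> \<open>Hence the conditional variance of an increment of \<open>M\<close> is the
    expected drop of \<open>W\<close>.\<close>
  have D2: "cexp k (\<lambda>y. (M (Suc k) y - M k x)\<^sup>2) x = W k x - cexp k (W (Suc k)) x"
    if k: "k < N" and x: "x \<in> space \<Omega>" for k x
  proof -
    have "cexp k (\<lambda>y. (M (Suc k) y)\<^sup>2) x + cexp k (W (Suc k)) x = (M k x)\<^sup>2 + W k x"
      using sqM[OF k x] k x bM[of "Suc k"] bW[of "Suc k"] by (subst (asm) cexp_add) auto
    then show ?thesis
      using cexp_variance[of k x "M (Suc k)" "M k x"] k x bM[of "Suc k"] MM[OF k x]
      by (simp add: power2_eq_square)
  qed
  define v where "v k x = W k x - cexp k (W (Suc k)) x" for k x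
  have v: "0 \<le> v k x" "v k x \<le> e\<^sup>2" if k: "k < N" and x: "x \<in> space \<Omega>" for k x
  proof -
    interpret prob_space "Q k x" using k x prob_space_Q by simp
    have bD: "bounded_measurable \<Omega> (\<lambda>y. (M (Suc k) y - M k x)\<^sup>2)"
      using bM[of "Suc k"] k by (intro bounded_measurable_power bounded_measurable_diff bounded_measurable_const) auto
    have "AE y in Q k x. (M (Suc k) y - M k x)\<^sup>2 \<le> e\<^sup>2"
      using incr[OF k x] by eventually_elim (use e in \<open>simp add: M_def abs_le_square_iff[symmetric]\<close>)
    then have "cexp k (\<lambda>y. (M (Suc k) y - M k x)\<^sup>2) x \<le> e\<^sup>2"
      unfolding cexp_def by (intro integral_le_const integrable_Q bD) (use k x in auto)
    then show "v k x \<le> e\<^sup>2" using D2[OF k x] by (simp add: v_def)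
    show "0 \<le> v k x" using D2[OF k x] cexp_nonneg[of k x "\<lambda>y. (M (Suc k) y - M k x)\<^sup>2"] k x
      by (simp add: v_def)
  qed
  have bv: "bounded_measurable \<Omega> (v k)" if "k < N" for k
    using that bW[of k] bW[of "Suc k"] unfolding v_def[abs_def] by auto
  have tow: "cexp 0 (cexp k F) x0 = cexp 0 F x0" if "k \<le> N" "bounded_measurable \<Omega> F" for k and F :: "'a \<Rightarrow> real"
    using tower[of 0 k x0 F] that x0 by simp
  have wv: "cexp 0 (v k) x0 = w k - w (Suc k)" if k: "k < N" for k
    using k x0 bW[of k] bW[of "Suc k"] tow[of k "W (Suc k)"]
    by (simp add: v_def[abs_def] w_def cexp_diff bounded_measurable_cexp)
  have dw: "0 \<le> w k - w (Suc k)" "w k - w (Suc k) \<le> e\<^sup>2" if k: "k < N" for k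
  proof -
    show "0 \<le> w k - w (Suc k)" using cexp_nonneg[of 0 x0 "v k"] v k x0 wv[OF k] by simp
    have "norm (cexp 0 (v k) x0) \<le> e\<^sup>2" by (rule cexp_bound) (use v k x0 in auto)
    then show "w k - w (Suc k) \<le> e\<^sup>2" using wv[OF k] by simp
  qed
  \<comment> \<open>The conditional second moment of the increment of \<open>W\<close>. It is
    centred at \<open>W k x\<close> rather than at the conditional mean; expanding the square in
    \<open>G_eq\<close> then leaves a difference that telescopes in expectation and a term in
    \<open>W k x * v k x\<close>.\<close>
  define G where "G k x = cexp k (\<lambda>y. (W k x - W (Suc k) y)\<^sup>2) x" for k x
  have G_eq: "G k x = cexp k (\<lambda>y. (W (Suc k) y)\<^sup>2) x - (W k x)\<^sup>2 + 2 * (W k x * v k x)"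
    if k: "k < N" and x: "x \<in> space \<Omega>" for k x
    using cexp_variance[of k x "W (Suc k)" "W k x"] k x bW[of "Suc k"]
    by (simp add: G_def v_def power2_commute[of "W k x"] algebra_simps power2_eq_square)
  define r where "r k = cexp 0 (\<lambda>y. (W k y)\<^sup>2) x0" for k
  have bG: "bounded_measurable \<Omega> (\<lambda>x. cexp k (\<lambda>y. (W (Suc k) y)\<^sup>2) x - (W k x)\<^sup>2 + 2 * (W k x * v k x))"
    if k: "k < N" for k
    using k bW[of k] bW[of "Suc k"] bv[OF k] by (intro bounded_measurable_add bounded_measurable_diff bounded_measurable_mult bounded_measurable_cexp bounded_measurable_power bounded_measurable_const) auto
  have G_le: "cexp 0 (G k) x0 \<le> r (Suc k) - r k + (w k)\<^sup>2 - (w (Suc k))\<^sup>2 + 3 * e\<^sup>2 * (w k - w (Suc k))"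
    if k: "k < N" for k
  proof -
    have "cexp 0 (G k) x0 = cexp 0 (\<lambda>x. cexp k (\<lambda>y. (W (Suc k) y)\<^sup>2) x - (W k x)\<^sup>2 + 2 * (W k x * v k x)) x0"
      by (rule cexp_cong) (use G_eq k x0 in auto)
    also have "\<dots> = r (Suc k) - r k + 2 * cexp 0 (\<lambda>x. W k x * v k x) x0"
      using k x0 bW[of k] bW[of "Suc k"] bv[OF k] tow[of k "\<lambda>y. (W (Suc k) y)\<^sup>2"]
      by (subst cexp_add) (auto simp: cexp_diff cexp_cmult bounded_measurable_power bounded_measurable_cexp r_def)
    \<comment> \<open>Replacing \<open>W k\<close> by \<open>w k\<close> costs
      \<open>2 * e^2\<close> per unit of drop of \<open>w\<close>. In
      \<open>2 * w k * (w k - w (Suc k))\<close> the part \<open>(w k)^2 - (w (Suc k))^2\<close>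
      telescopes, and the square of the drop that remains costs one more \<open>e^2\<close>.\<close>
    also have "cexp 0 (\<lambda>x. W k x * v k x) x0 \<le> cexp 0 (\<lambda>x. (w k + e\<^sup>2) * v k x) x0"
    proof (rule cexp_mono)
      fix y assume y: "y \<in> space \<Omega>"
      show "W k y * v k y \<le> (w k + e\<^sup>2) * v k y"
        using Ww[of k y] v[OF k y] y k by (intro mult_right_mono) auto
    qed (use k x0 bW[of k] bv[OF k] in auto)
    also have "\<dots> = (w k + e\<^sup>2) * (w k - w (Suc k))"
      using x0 wv[OF k] by (simp add: cexp_cmult)
    finally have "cexp 0 (G k) x0 \<le> r (Suc k) - r k + 2 * ((w k + e\<^sup>2) * (w k - w (Suc k)))" by simp
    moreover have "(w k - w (Suc k)) * (w k - w (Suc k)) \<le> e\<^sup>2 * (w k - w (Suc k))"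
      using dw[OF k] by (intro mult_right_mono) auto
    ultimately show ?thesis by (simp add: algebra_simps power2_eq_square)
  qed
  have ends: "w 0 = 1" "r 0 = 1" "w N = 0" "r N = 0"
  proof -
    have "w 0 = cexp 0 (\<lambda>_. 1) x0" unfolding w_def by (rule cexp_cong) (use W0 x0 in auto)
    then show "w 0 = 1" using x0 by (simp add: cexp_const)
    have "r 0 = cexp 0 (\<lambda>_. 1) x0" unfolding r_def by (rule cexp_cong) (use W0 x0 in auto)
    then show "r 0 = 1" using x0 by (simp add: cexp_const)
    have "w N = cexp 0 (\<lambda>_. 0) x0" unfolding w_def by (rule cexp_cong) (use WN x0 in auto)
    then show "w N = 0" using x0 by (simp add: cexp_const)
    have "r N = cexp 0 (\<lambda>_. 0) x0" unfolding r_def by (rule cexp_cong) (use WN x0 in auto)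
    then show "r N = 0" using x0 by (simp add: cexp_const)
  qed
  define g where "g k x = exp (\<i> * complex_of_real (t * M k x) + of_real (- (t\<^sup>2 * W k x / 2)))" for k x
  \<comment> \<open>The real part of the exponent is nonpositive because \<open>W\<close> is
    nonnegative.\<close>
  have g_norm: "norm (g k x) \<le> 1" if "k \<le> N" "x \<in> space \<Omega>" for k x
    using Wnn[OF that] by (simp add: g_def)
  have bg: "bounded_measurable \<Omega> (g k)" if "k \<le> N" for k
  proof (rule bounded_measurableI)
    note [measurable] = bM[OF that, THEN bounded_measurableD] bW[OF that, THEN bounded_measurableD]
    show "g k \<in> borel_measurable \<Omega>" unfolding g_def by measurable
  qed (use g_norm that in auto)
  have step: "norm (cexp k (g (Suc k)) x - g k x) \<le> c1 * v k x + c2 * G k x"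
    if k: "k < N" and x: "x \<in> space \<Omega>" for k x
  proof -
    interpret prob_space "Q k x" using k x prob_space_Q by simp
    define D where "D y = M (Suc k) y - M k x" for y
    define G' where "G' y = W k x - W (Suc k) y" for y
    let ?E = "\<lambda>y. exp (\<i> * complex_of_real (t * D y) + of_real (t\<^sup>2 * G' y / 2))"
    have "g (Suc k) y = g k x * ?E y" for y
      by (simp add: g_def D_def G'_def algebra_simps diff_divide_distrib flip: exp_add)
    then have "cexp k (g (Suc k)) x - g k x = g k x * (cexp k ?E x - 1)"
      using k x by (simp add: cexp_cmult algebra_simps cong: cexp_cong)
    then have "norm (cexp k (g (Suc k)) x - g k x) = norm (g k x) * norm (cexp k ?E x - 1)"
      by (simp add: norm_mult)
    also have "\<dots> \<le> norm (cexp k ?E x - 1)"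
      using g_norm[of k x] k x by (intro mult_left_le_one_le) auto
    also have "\<dots> \<le> c1 * (\<integral>y. (D y)\<^sup>2 \<partial>Q k x) + c2 * (\<integral>y. (G' y)\<^sup>2 \<partial>Q k x)"
      unfolding cexp_def c1_def c2_def q_def
    proof (rule compensated_exp_expectation)
      show "bounded_measurable (Q k x) D" "bounded_measurable (Q k x) G'"
        unfolding D_def[abs_def] G'_def[abs_def] using k x bM[of "Suc k"] bW[of "Suc k"]
        by (auto intro!: bounded_measurable_diff bounded_measurable_Q)
      show "AE y in Q k x. \<bar>D y\<bar> \<le> e" using incr[OF k x] by (simp add: D_def M_def)
      show "AE y in Q k x. \<bar>G' y\<bar> \<le> 3 * e\<^sup>2"
      proof (rule AE_I2)
        fix y assume "y \<in> space (Q k x)"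
        then have "y \<in> space \<Omega>" using k x space_Q by simp
        \<comment> \<open>From \<open>W k x\<close> to \<open>w k\<close>, on to
          \<open>w (Suc k)\<close> and to \<open>W (Suc k) y\<close>, at a cost of
          \<open>e^2\<close> each.\<close>
        then show "\<bar>G' y\<bar> \<le> 3 * e\<^sup>2"
          using Ww[of k x] Ww[of "Suc k" y] dw[OF k] k x unfolding G'_def by linarith
      qed
      have "cexp k D x = 0"
        using k x bM[of "Suc k"] MM[OF k x] by (simp add: D_def[abs_def] cexp_diff cexp_const)
      then show "(\<integral>y. D y \<partial>Q k x) = 0" by (simp add: cexp_def)
      have "cexp k G' x = v k x"
        using k x bW[of "Suc k"] by (simp add: G'_def[abs_def] cexp_diff cexp_const v_def)
      then show "(\<integral>y. G' y \<partial>Q k x) = (\<integral>y. (D y)\<^sup>2 \<partial>Q k x)"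
        using D2[OF k x] by (simp add: cexp_def D_def v_def)
    qed (use e q in \<open>auto simp: q_def\<close>)
    finally show ?thesis
      using D2[OF k x] by (simp add: v_def G_def cexp_def D_def G'_def)
  qed
  have telescope: "norm (cexp 0 (g (Suc k)) x0 - cexp 0 (g k) x0)
       \<le> c1 * (w k - w (Suc k)) + c2 * cexp 0 (G k) x0" if k: "k < N" for k
  proof -
    interpret prob_space "Q 0 x0" using x0 prob_space_Q by simp
    \<comment> \<open>In \<open>G k x\<close> the integrand itself depends on \<open>x\<close>, so
      measurability is read off from the expanded form.\<close>
    have bG': "bounded_measurable \<Omega> (G k)"
      using bG[OF k] G_eq[OF k] unfolding bounded_measurable_def by (simp cong: measurable_cong)
    have bc: "bounded_measurable \<Omega> (\<lambda>x. cexp k (g (Suc k)) x - g k x)"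
      using k bg[of k] bg[of "Suc k"] by auto
    have eq: "cexp 0 (g (Suc k)) x0 - cexp 0 (g k) x0 = cexp 0 (\<lambda>x. cexp k (g (Suc k)) x - g k x) x0"
      using k x0 bg[of k] bg[of "Suc k"] tower_complex[of 0 k x0 "g (Suc k)"]
      by (simp add: cexp_diff bounded_measurable_cexp)
    have "norm (cexp 0 (g (Suc k)) x0 - cexp 0 (g k) x0) \<le> cexp 0 (\<lambda>x. norm (cexp k (g (Suc k)) x - g k x)) x0"
      unfolding eq unfolding cexp_def[of 0] by (rule integral_norm_bound)
    also have "\<dots> \<le> cexp 0 (\<lambda>x. c1 * v k x + c2 * G k x) x0"
    proof (rule cexp_mono)
      show "bounded_measurable \<Omega> (\<lambda>x. norm (cexp k (g (Suc k)) x - g k x))"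
        using bc unfolding bounded_measurable_def by auto
    qed (use x0 k bG' bv[OF k] step in auto)
    also have "\<dots> = c1 * (w k - w (Suc k)) + c2 * cexp 0 (G k) x0"
      using x0 k bG' bv[OF k] wv[OF k] by (subst cexp_add) (auto simp: cexp_cmult)
    finally show ?thesis .
  qed
  \<comment> \<open>The \<open>- 1 + 1\<close> is \<open>- r 0 + (w 0)^2\<close>. Since
    \<open>r\<close> and \<open>w\<close> both fall from 1 to 0, at \<open>n = N\<close> the factor
    of \<open>c2\<close> collapses to \<open>3 * e^2\<close>: this is the smallness of the quadratic
    variation of \<open>W\<close>.\<close>
  have "norm (cexp 0 (g n) x0 - cexp 0 (g 0) x0)
     \<le> c1 * (1 - w n) + c2 * (r n - 1 + 1 - (w n)\<^sup>2 + 3 * e\<^sup>2 * (1 - w n))" if "n \<le> N" for n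
    using that
  proof (induction n)
    case 0
    then show ?case by (simp add: ends)
  next
    case (Suc n)
    have "norm (cexp 0 (g (Suc n)) x0 - cexp 0 (g 0) x0)
       \<le> norm (cexp 0 (g (Suc n)) x0 - cexp 0 (g n) x0) + norm (cexp 0 (g n) x0 - cexp 0 (g 0) x0)"
      using norm_triangle_ineq[of "cexp 0 (g (Suc n)) x0 - cexp 0 (g n) x0" "cexp 0 (g n) x0 - cexp 0 (g 0) x0"] by simp
    also have "\<dots> \<le> (c1 * (w n - w (Suc n)) + c2 * (r (Suc n) - r n + (w n)\<^sup>2 - (w (Suc n))\<^sup>2 + 3 * e\<^sup>2 * (w n - w (Suc n))))
        + (c1 * (1 - w n) + c2 * (r n - 1 + 1 - (w n)\<^sup>2 + 3 * e\<^sup>2 * (1 - w n)))"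
      using Suc telescope[of n] mult_left_mono[OF G_le[of n] c(2)] by (intro add_mono) auto
    also have "\<dots> = c1 * (1 - w (Suc n)) + c2 * (r (Suc n) - 1 + 1 - (w (Suc n))\<^sup>2 + 3 * e\<^sup>2 * (1 - w (Suc n)))"
      by (simp add: algebra_simps)
    finally show ?case .
  qed
  from this[of N] have "norm (cexp 0 (g N) x0 - cexp 0 (g 0) x0) \<le> c1 + c2 * (3 * e\<^sup>2)"
    by (simp add: ends)
  moreover have "cexp 0 (g N) x0 = cexp 0 (\<lambda>y. exp (\<i> * of_real (t * H y))) x0"
    by (rule cexp_cong) (use x0 WN terminal H in \<open>auto simp: g_def M_def\<close>)
  moreover have "cexp 0 (g 0) x0 = cexp 0 (\<lambda>_. of_real (exp (- t\<^sup>2 / 2))) x0"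
    by (rule cexp_cong) (use x0 W0 mean in \<open>auto simp: g_def M_def exp_of_real[symmetric]\<close>)
  ultimately show ?thesis
    using x0 by (simp add: c1_def c2_def cexp_const)
qed

end

subsection \<open>The path measure of a Markov chain\<close>

locale path_chain =
  fixes S :: "'a measure" and N :: nat and \<nu> :: "'a measure" and K :: "nat \<Rightarrow> 'a \<Rightarrow> 'a measure"
  assumes initial: "\<nu> \<in> space (prob_algebra S)"
    and K: "k \<in> {1..<N} \<Longrightarrow> K k \<in> S \<rightarrow>\<^sub>M prob_algebra S"
begin

definition paths :: "(nat \<Rightarrow> 'a) measure" where
  "paths = Pi\<^sub>M {1..N} (\<lambda>_. S)"

text \<open>Treating the initial law as a kernel from time \<open>0\<close> makes the trivial \<open>\<sigma>\<close>-algebra the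
  zeroth member of the filtration.\<close>

definition next_law :: "nat \<Rightarrow> (nat \<Rightarrow> 'a) \<Rightarrow> 'a measure" where
  "next_law k x = (if k = 0 then \<nu> else K k (x k))"

text \<open>The recursion counts the steps still to come. With \<open>Suc r\<close> of them left the
  current time is \<open>N - Suc r\<close> and the coordinate drawn is \<open>N - r\<close>. The
  later coordinates of \<open>x\<close> get overwritten, so a full path can serve as the argument at
  every time.\<close>

primrec remaining_law :: "nat \<Rightarrow> (nat \<Rightarrow> 'a) \<Rightarrow> (nat \<Rightarrow> 'a) measure" where
  "remaining_law 0 x = return paths x"
| "remaining_law (Suc r) x = next_law (N - Suc r) x \<bind> (\<lambda>y. remaining_law r (x(N - r := y)))"

definition path_law :: "nat \<Rightarrow> (nat \<Rightarrow> 'a) \<Rightarrow> (nat \<Rightarrow> 'a) measure" where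
  "path_law k = remaining_law (N - k)"

lemma path_law_step:
  assumes "k < N"
  shows "path_law k x = next_law k x \<bind> (\<lambda>y. path_law (Suc k) (x(Suc k := y)))"
proof -
  have "N - k = Suc (N - Suc k)" "N - Suc (N - Suc k) = k" "N - (N - Suc k) = Suc k"
    using assms by auto
  then show ?thesis by (simp add: path_law_def)
qed

section \<open>Measurability of the path kernels\<close>

lemma measurable_upd [measurable]:
  assumes "k < N" shows "(\<lambda>(x, y). x(Suc k := y)) \<in> paths \<Otimes>\<^sub>M S \<rightarrow>\<^sub>M paths"
  using measurable_add_dim[of "Suc k" "{1..N}" "\<lambda>_. S"] assms by (simp add: paths_def insert_absorb)

lemma measurable_upd2:
  assumes "k < N" "x \<in> space paths" shows "(\<lambda>y. x(Suc k := y)) \<in> S \<rightarrow>\<^sub>M paths"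
  using measurable_compose[OF measurable_Pair1' measurable_upd] assms by fastforce

lemma upd_in_paths:
  "k < N \<Longrightarrow> x \<in> space paths \<Longrightarrow> y \<in> space S \<Longrightarrow> x(Suc k := y) \<in> space paths"
  using measurable_upd2 measurable_space by metis

lemma measurable_next_law:
  assumes "k < N" shows "next_law k \<in> paths \<rightarrow>\<^sub>M prob_algebra S"
proof (cases "k = 0")
  case True
  then show ?thesis using initial by (simp add: next_law_def[abs_def])
next
  case False
  then have "(\<lambda>x. K k (x k)) \<in> paths \<rightarrow>\<^sub>M prob_algebra S"
    unfolding paths_def using assms K[of k]
    by (intro measurable_compose[OF measurable_component_singleton]) auto
  then show ?thesis using False by (simp add: next_law_def[abs_def])
qed

lemma next_law_prob:
  assumes "k < N" "x \<in> space paths"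
  shows "next_law k x \<in> space (prob_algebra S)" "prob_space (next_law k x)"
    "sets (next_law k x) = sets S" "space (next_law k x) = space S"
  using measurable_space[OF measurable_next_law] assms
  by (auto simp: space_prob_algebra dest: sets_eq_imp_space_eq)

lemma measurable_remaining_law: "r \<le> N \<Longrightarrow> remaining_law r \<in> paths \<rightarrow>\<^sub>M prob_algebra paths"
proof (induction r)
  case 0
  have "return paths \<in> paths \<rightarrow>\<^sub>M prob_algebra paths"
    by (rule measurable_return_prob_space)
  then show ?case by (simp add: remaining_law.simps(1)[abs_def])
next
  case (Suc r)
  have eq: "N - r = Suc (N - Suc r)" and lt: "N - Suc r < N" using Suc.prems by auto
  have "(\<lambda>z. remaining_law r ((\<lambda>(x, y). x(Suc (N - Suc r) := y)) z)) \<in> paths \<Otimes>\<^sub>M S \<rightarrow>\<^sub>M prob_algebra paths"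
    by (rule measurable_compose[OF measurable_upd[OF lt]]) (use Suc in auto)
  then have "(\<lambda>(x, y). remaining_law r (x(N - r := y))) \<in> paths \<Otimes>\<^sub>M S \<rightarrow>\<^sub>M prob_algebra paths"
    by (simp add: eq case_prod_beta')
  then have "(\<lambda>x. next_law (N - Suc r) x \<bind> (\<lambda>y. remaining_law r (x(N - r := y)))) \<in> paths \<rightarrow>\<^sub>M prob_algebra paths"
    by (rule measurable_bind_prob_space2[OF measurable_next_law[OF lt]])
  then show ?case by (simp add: remaining_law.simps(2)[abs_def])
qed

lemma measurable_path_law: "path_law k \<in> paths \<rightarrow>\<^sub>M prob_algebra paths"
  unfolding path_law_def by (rule measurable_remaining_law) simp

text \<open>A real-valued forerunner of \<open>cexp\<close>: the tower and terminal properties have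
  to be established for it before the sublocale makes \<open>cexp\<close> available.\<close>

definition E :: "nat \<Rightarrow> ((nat \<Rightarrow> 'a) \<Rightarrow> real) \<Rightarrow> (nat \<Rightarrow> 'a) \<Rightarrow> real" where
  "E k H x = (\<integral>z. H z \<partial>path_law k x)"

lemma E_terminal: "x \<in> space paths \<Longrightarrow> bounded_measurable paths H \<Longrightarrow> E N H x = H x"
  by (simp add: E_def path_law_def integral_return bounded_measurableD)

lemma E_step:
  assumes "k < N" "x \<in> space paths" "bounded_measurable paths H"
  shows "E k H x = (\<integral>y. E (Suc k) H (x(Suc k := y)) \<partial>next_law k x)"
  unfolding E_def path_law_step[OF assms(1)]
  by (rule integral_bind_bounded_measurable[OF next_law_prob(1)[OF assms(1,2)] _ assms(3)])
    (rule measurable_compose[OF measurable_upd2[OF assms(1,2)] measurable_path_law])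

lemma bounded_measurable_E [intro!]:
  assumes "bounded_measurable paths H"
  shows "bounded_measurable paths (E k H)"
proof -
  obtain B where B: "\<And>x. x \<in> space paths \<Longrightarrow> norm (H x) \<le> B"
    using assms unfolding bounded_measurable_def by blast
  have "(\<lambda>x. \<integral>z. H z \<partial>path_law k x) \<in> borel_measurable paths"
    by (rule measurable_compose[OF measurable_prob_algebraD[OF measurable_path_law]
          integral_measurable_subprob_algebra[OF bounded_measurableD[OF assms]]])
  then have "E k H \<in> borel_measurable paths" by (simp add: E_def[abs_def])
  then show ?thesis
  proof (rule bounded_measurableI)
    fix x assume "x \<in> space paths"
    then have *: "prob_space (path_law k x)" "sets (path_law k x) = sets paths"
      using measurable_space[OF measurable_path_law] by (auto simp: space_prob_algebra)
    then interpret prob_space "path_law k x" by simp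
    show "norm (E k H x) \<le> B"
      unfolding E_def by (rule integral_norm_le_const) (use B sets_eq_imp_space_eq[OF *(2)] in auto)
  qed
qed

text \<open>Plays the role of measurability with respect to the coordinates in \<open>A\<close>.
  Being a statement about values at every path, it can be applied directly when other coordinates
  are redrawn, which is how the kernels act.\<close>

definition depends_on :: "nat set \<Rightarrow> ((nat \<Rightarrow> 'a) \<Rightarrow> 'b) \<Rightarrow> bool" where
  "depends_on A H \<longleftrightarrow> (\<forall>x\<in>space paths. \<forall>y\<in>space paths. (\<forall>j\<in>A. x j = y j) \<longrightarrow> H x = H y)"

lemma depends_onD:
  "depends_on A H \<Longrightarrow> x \<in> space paths \<Longrightarrow> y \<in> space paths \<Longrightarrow> (\<And>j. j \<in> A \<Longrightarrow> x j = y j) \<Longrightarrow> H x = H y"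
  unfolding depends_on_def by blast

lemma depends_on_mono: "depends_on A H \<Longrightarrow> A \<subseteq> B \<Longrightarrow> depends_on B H"
  unfolding depends_on_def by blast

lemma depends_on_comp: "depends_on A F \<Longrightarrow> depends_on A (\<lambda>x. h (F x))"
  unfolding depends_on_def by metis

lemma depends_on_sum: "(\<And>i. i \<in> I \<Longrightarrow> depends_on A (F i)) \<Longrightarrow> depends_on A (\<lambda>x. \<Sum>i\<in>I. F i x)"
  unfolding depends_on_def by (intro ballI impI sum.cong refl) blast

lemma depends_on_all: "depends_on {1..N} H"
proof -
  have "x = y" if "x \<in> space paths" "y \<in> space paths" "\<forall>j\<in>{1..N}. x j = y j" for x y
    using that by (intro PiE_ext) (auto simp: paths_def space_PiM)
  then show ?thesis unfolding depends_on_def by metis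
qed

text \<open>With \<open>l = k\<close> this is the Markov property.\<close>

lemma depends_on_E:
  assumes H: "bounded_measurable paths H" "depends_on {l..N} H" and l: "1 \<le> l"
  shows "k \<le> N \<Longrightarrow> l \<le> max 1 k \<Longrightarrow> depends_on {l..k} (E k H)"
proof (induction k rule: inc_induct)
  case base
  show ?case
    unfolding depends_on_def
  proof (intro ballI impI)
    fix x x' assume "x \<in> space paths" "x' \<in> space paths" "\<forall>j\<in>{l..N}. x j = x' j"
    then show "E N H x = E N H x'"
      using depends_onD[OF H(2)] E_terminal[OF _ H(1)] by metis
  qed
next
  case (step k)
  show ?case
    unfolding depends_on_def
  proof (intro ballI impI)
    fix x x' assume x: "x \<in> space paths" "x' \<in> space paths" and eq: "\<forall>j\<in>{l..k}. x j = x' j"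
    \<comment> \<open>For \<open>k > 0\<close> the condition \<open>l \<le> max 1 k\<close> puts
      coordinate \<open>k\<close> into the shared range. For \<open>k = 0\<close> that range is
      empty, but the next law is \<open>\<nu>\<close> on both sides.\<close>
    have "next_law k x = next_law k x'"
      using eq step.prems l by (cases "k = 0") (auto simp: next_law_def)
    moreover have "E (Suc k) H (x(Suc k := y)) = E (Suc k) H (x'(Suc k := y))" if "y \<in> space S" for y
    proof (rule depends_onD[OF step.IH])
      show "l \<le> max 1 (Suc k)" using step.prems by simp
      show "x(Suc k := y) \<in> space paths" "x'(Suc k := y) \<in> space paths"
        by (rule upd_in_paths[OF step.hyps(2)]; fact)+
      show "(x(Suc k := y)) j = (x'(Suc k := y)) j" if "j \<in> {l..Suc k}" for j
        using that eq by auto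
    qed
    ultimately show "E k H x = E k H x'"
      unfolding E_step[OF step.hyps(2) x(1) H(1)] E_step[OF step.hyps(2) x(2) H(1)]
      using next_law_prob(4)[OF step.hyps(2) x(2)]
      by (auto intro!: Bochner_Integration.integral_cong)
  qed
qed

lemma depends_on_E_all: "bounded_measurable paths H \<Longrightarrow> k \<le> N \<Longrightarrow> depends_on {1..k} (E k H)"
  by (rule depends_on_E[OF _ depends_on_all]) auto

text \<open>Redrawing coordinates after \<open>k\<close> leaves \<open>g\<close> unchanged, so it
  comes out of each one-step integral in turn.\<close>

lemma E_pullout:
  assumes g: "bounded_measurable paths g" and H: "bounded_measurable paths H"
  shows "k \<le> N \<Longrightarrow> depends_on {1..k} g \<Longrightarrow> x \<in> space paths \<Longrightarrow> E k (\<lambda>y. g y * H y) x = g x * E k H x"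
proof (induction k arbitrary: x rule: inc_induct)
  case base
  then show ?case using g H by (simp add: E_terminal bounded_measurable_mult)
next
  case (step k)
  have gH: "bounded_measurable paths (\<lambda>y. g y * H y)" using g H by auto
  have "E k (\<lambda>y. g y * H y) x = (\<integral>y. g x * E (Suc k) H (x(Suc k := y)) \<partial>next_law k x)"
    unfolding E_step[OF step.hyps(2) step.prems(2) gH]
  proof (rule Bochner_Integration.integral_cong)
    fix y assume "y \<in> space (next_law k x)"
    then have xy: "x(Suc k := y) \<in> space paths"
      using next_law_prob(4)[OF step.hyps(2) step.prems(2)] upd_in_paths[OF step.hyps(2) step.prems(2)] by metis
    have "g (x(Suc k := y)) = g x"
      by (rule depends_onD[OF step.prems(1) xy step.prems(2)]) auto
    moreover have "depends_on {1..Suc k} g"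
      by (rule depends_on_mono[OF step.prems(1)]) auto
    ultimately show "E (Suc k) (\<lambda>y. g y * H y) (x(Suc k := y)) = g x * E (Suc k) H (x(Suc k := y))"
      using step.IH xy by simp
  qed simp
  then show ?case
    using E_step[OF step.hyps(2) step.prems(2) H] by simp
qed

lemma E_one: "x \<in> space paths \<Longrightarrow> E k (\<lambda>_. 1) x = 1"
  using measurable_space[OF measurable_path_law]
  by (auto simp: E_def space_prob_algebra prob_space.prob_space)

lemma E_of_past:
  assumes "k \<le> N" "x \<in> space paths" "bounded_measurable paths g" "depends_on {1..k} g"
  shows "E k g x = g x"
  using E_pullout[OF assms(3) bounded_measurable_const assms(1,4,2), of 1] assms E_one by simp

text \<open>The downward induction starts at \<open>k = l\<close>, where \<open>E l H\<close> is a
  function of the first \<open>l\<close> coordinates and conditioning leaves it fixed. Below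
  \<open>l\<close> both sides unfold the same kernel.\<close>

lemma E_tower:
  assumes H: "bounded_measurable paths H" and l: "l \<le> N"
  shows "k \<le> l \<Longrightarrow> x \<in> space paths \<Longrightarrow> E k (E l H) x = E k H x"
proof (induction k arbitrary: x rule: inc_induct)
  case base
  show ?case
    by (rule E_of_past) (use base H l depends_on_E_all in auto)
next
  case (step k)
  have k: "k < N" using step l by simp
  have "E (Suc k) (E l H) (x(Suc k := y)) = E (Suc k) H (x(Suc k := y))" if "y \<in> space S" for y
    by (rule step.IH[OF upd_in_paths[OF k step.prems that]])
  then show ?case
    unfolding E_step[OF k step.prems bounded_measurable_E[OF H]] E_step[OF k step.prems H]
    using next_law_prob(4)[OF k step.prems]
    by (auto intro!: Bochner_Integration.integral_cong)
qed

lemma E_step_of_past: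
  assumes "k < N" "x \<in> space paths" "bounded_measurable paths h" "depends_on {1..Suc k} h"
  shows "E k h x = (\<integral>y. h (x(Suc k := y)) \<partial>next_law k x)"
  unfolding E_step[OF assms(1-3)]
proof (rule Bochner_Integration.integral_cong)
  fix y assume "y \<in> space (next_law k x)"
  then have "x(Suc k := y) \<in> space paths"
    using next_law_prob(4)[OF assms(1,2)] upd_in_paths[OF assms(1,2)] by metis
  then show "E (Suc k) h (x(Suc k := y)) = h (x(Suc k := y))"
    using assms by (intro E_of_past) auto
qed simp

sublocale conditional_kernels paths path_law N
proof
  show "path_law k \<in> paths \<rightarrow>\<^sub>M prob_algebra paths" for k by (rule measurable_path_law)
qed (use E_tower E_terminal in \<open>auto simp: E_def E_def[abs_def]\<close>)

lemma E_eq_cexp: "E k H x = cexp k H x"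
  by (simp add: E_def cexp_def)

text \<open>Under \<open>path_law k x\<close> almost every path agrees with \<open>x\<close> up to
  time \<open>k\<close>, so a function of the first \<open>Suc k\<close> coordinates need only be
  checked on updates of \<open>x\<close> at \<open>Suc k\<close>. In the proof the indicator of a
  violation is shown to integrate to 0.\<close>

lemma AE_path_law:
  assumes k: "k < N" and x: "x \<in> space paths" and h: "bounded_measurable paths h" "depends_on {1..Suc k} h"
    and le: "\<And>y. y \<in> space S \<Longrightarrow> h (x(Suc k := y)) \<le> (c::real)"
  shows "AE z in path_law k x. h z \<le> c"
proof -
  interpret prob_space "path_law k x" using k x prob_space_Q by simp
  define b where "b z = (if h z \<le> c then 0 else 1 :: real)" for z
  have [measurable]: "h \<in> borel_measurable paths" using h by (rule_tac bounded_measurableD)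
  have b: "bounded_measurable paths b"
  proof (rule bounded_measurableI)
    show "b \<in> borel_measurable paths" unfolding b_def by measurable
    show "norm (b z) \<le> 1" for z by (simp add: b_def)
  qed
  have "E k b x = (\<integral>y. b (x(Suc k := y)) \<partial>next_law k x)"
    by (rule E_step_of_past) (use k x b h in \<open>auto simp: b_def[abs_def] intro: depends_on_comp\<close>)
  also have "\<dots> = (\<integral>y. 0 \<partial>next_law k x)"
    using le next_law_prob(4)[OF k x] by (intro Bochner_Integration.integral_cong) (auto simp: b_def)
  finally have "(\<integral>z. b z \<partial>path_law k x) = 0" by (simp add: E_def)
  then have "AE z in path_law k x. b z = 0"
    using k x b by (subst (asm) integral_nonneg_eq_0_iff_AE) (auto simp: b_def intro!: integrable_Q)
  then show ?thesis by eventually_elim (simp add: b_def split: if_splits)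
qed

text \<open>\<open>E k H x\<close> is an average of \<open>E (Suc k) H\<close> over the next
  coordinate, and no value is farther from an average than the oscillation.\<close>

lemma AE_increment:
  assumes k: "k < N" and x: "x \<in> space paths" and H: "bounded_measurable paths H"
    and osc: "\<And>y y'. y \<in> space S \<Longrightarrow> y' \<in> space S \<Longrightarrow>
        \<bar>E (Suc k) H (x(Suc k := y)) - E (Suc k) H (x(Suc k := y'))\<bar> \<le> c"
  shows "AE z in path_law k x. \<bar>E (Suc k) H z - E k H x\<bar> \<le> c"
proof (rule AE_path_law[OF k x])
  interpret L: prob_space "next_law k x" using next_law_prob[OF k x] by simp
  show "depends_on {1..Suc k} (\<lambda>z. \<bar>E (Suc k) H z - E k H x\<bar>)"
    using k H by (intro depends_on_comp[where h="\<lambda>a. \<bar>a - E k H x\<bar>"] depends_on_E_all) auto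
  have "bounded_measurable paths (\<lambda>z. E (Suc k) H z - E k H x)" using H by auto
  then show "bounded_measurable paths (\<lambda>z. \<bar>E (Suc k) H z - E k H x\<bar>)"
    unfolding bounded_measurable_def by auto
  fix y assume y: "y \<in> space S"
  have bm: "bounded_measurable S (\<lambda>y'. E (Suc k) H (x(Suc k := y')))"
    by (rule bounded_measurable_comp[OF bounded_measurable_E[OF H] measurable_upd2[OF k x]])
  have int: "integrable (next_law k x) (\<lambda>y'. E (Suc k) H (x(Suc k := y')))"
    by (rule L.integrable_bounded_measurable[OF bm]) (use next_law_prob[OF k x] in simp)
  have eq: "E (Suc k) H (x(Suc k := y)) - E k H x
      = (\<integral>y'. E (Suc k) H (x(Suc k := y)) - E (Suc k) H (x(Suc k := y')) \<partial>next_law k x)"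
    using int unfolding E_step[OF k x H] by (simp add: L.prob_space)
  have "norm (E (Suc k) H (x(Suc k := y)) - E k H x) \<le> c"
    unfolding eq by (rule L.integral_norm_le_const) (use osc y next_law_prob[OF k x] in auto)
  then show "\<bar>E (Suc k) H (x(Suc k := y)) - E k H x\<bar> \<le> c" by simp
qed

end

subsection \<open>Dobrushin contraction\<close>

text \<open>The sum counts the positive integers up to \<open>n * h\<close>, so it is the floor of
  \<open>n * h\<close>.\<close>

lemma unit_interval_step_approximation:
  fixes h :: real
  assumes "0 \<le> h" "h \<le> 1" "n > 0"
  shows "\<bar>h - (\<Sum>j=1..n. if real j \<le> n * h then 1 else 0) / n\<bar> \<le> 1 / n"
proof -
  let ?k = "nat \<lfloor>n * h\<rfloor>"
  have nh: "0 \<le> n * h" "n * h \<le> n" using assms by (auto simp: mult_left_le)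
  then have "\<lfloor>n * h\<rfloor> \<le> int n" by (simp add: floor_le_iff)
  then have "{j \<in> {1..n}. real j \<le> n * h} = {1..?k}"
    using nh by (auto simp: le_nat_iff le_floor_iff)
  then have "(\<Sum>j=1..n. if real j \<le> n * h then 1 else 0 :: real) = ?k"
    by (simp add: sum.If_cases Int_def)
  also have "real ?k = of_int \<lfloor>n * h\<rfloor>" using nh by simp
  finally have eq: "(\<Sum>j=1..n. if real j \<le> n * h then 1 else 0 :: real) = of_int \<lfloor>n * h\<rfloor>" .
  have "h - of_int \<lfloor>n * h\<rfloor> / n = (n * h - of_int \<lfloor>n * h\<rfloor>) / n"
    using assms by (simp add: field_simps)
  moreover have "\<bar>n * h - of_int \<lfloor>n * h\<rfloor>\<bar> \<le> 1" by linarith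
  ultimately show ?thesis
    unfolding eq using assms by (simp add: divide_right_mono)
qed

text \<open>Averages of indicators of superlevel sets approximate \<open>h\<close> uniformly, and an
  average of differences of size \<open>d\<close> is again of size \<open>d\<close>. Passing from
  sets to functions thus loses no factor 2; such a factor would destroy the contraction for small
  ergodic coefficients.\<close>

lemma integral_difference_unit:
  fixes h :: "'a \<Rightarrow> real"
  assumes M: "prob_space M" "sets M = sets S" and M': "prob_space M'" "sets M' = sets S"
    and d: "\<And>B. B \<in> sets S \<Longrightarrow> \<bar>measure M B - measure M' B\<bar> \<le> d"
    and h: "h \<in> borel_measurable S" "\<And>x. x \<in> space S \<Longrightarrow> 0 \<le> h x \<and> h x \<le> 1"
  shows "\<bar>(\<integral>x. h x \<partial>M) - (\<integral>x. h x \<partial>M')\<bar> \<le> d"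
proof (rule field_le_epsilon)
  fix e :: real assume "e > 0"
  obtain n :: nat where n': "2 / e < n" using reals_Archimedean2 by blast
  have "0 < 2 / e" using \<open>e > 0\<close> by simp
  then have n0: "n > 0" using n' by (metis less_trans of_nat_0_less_iff)
  then have n: "n > 0" "2 / n < e" using n' \<open>e > 0\<close> by (auto simp: field_simps)
  define u where "u x = (\<Sum>j=1..n. if real j \<le> n * h x then 1 else 0) / n" for x
  define B where "B j = {x \<in> space S. real j \<le> n * h x}" for j
  note [measurable] = h(1)
  have B: "B j \<in> sets S" for j unfolding B_def by measurable
  have approx: "\<bar>(\<integral>x. h x \<partial>L) - (\<Sum>j=1..n. measure L (B j)) / n\<bar> \<le> 1 / n"
    if L: "prob_space L" "sets L = sets S" for L
  proof -
    interpret prob_space L by fact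
    have sp: "space L = space S" using L(2) by (rule sets_eq_imp_space_eq)
    have iB: "integrable L (indicator (B j) :: 'a \<Rightarrow> real)" for j
      using B L by (intro integrable_real_indicator) (auto simp: emeasure_eq_measure)
    have u: "u x = (\<Sum>j=1..n. indicator (B j) x) / n" if "x \<in> space L" for x
      using that sp unfolding u_def B_def by (intro arg_cong2[where f="(/)"] sum.cong) (auto simp: indicator_def)
    have iu: "integrable L u" "(\<integral>x. u x \<partial>L) = (\<Sum>j=1..n. measure L (B j)) / n"
    proof -
      have "integrable L (\<lambda>x. (\<Sum>j=1..n. indicator (B j) x) / real n)"
        using iB by (intro integrable_divide integrable_sum) auto
      then show "integrable L u" using u by (simp cong: Bochner_Integration.integrable_cong)
      have "(\<integral>x. u x \<partial>L) = (\<integral>x. (\<Sum>j=1..n. indicator (B j) x) / real n \<partial>L)"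
        using u by (intro Bochner_Integration.integral_cong) auto
      also have "\<dots> = (\<Sum>j=1..n. measure L (B j)) / n"
        using iB B L by (simp add: Bochner_Integration.integral_sum) 
      finally show "(\<integral>x. u x \<partial>L) = (\<Sum>j=1..n. measure L (B j)) / n" .
    qed
    have ih: "integrable L h"
      using h sp L(2) by (intro integrable_const_bound[of _ 1]) (auto cong: measurable_cong_sets)
    have eq: "(\<integral>x. h x \<partial>L) - (\<integral>x. u x \<partial>L) = (\<integral>x. h x - u x \<partial>L)"
      using ih iu by simp
    have "norm ((\<integral>x. h x \<partial>L) - (\<integral>x. u x \<partial>L)) \<le> 1 / n"
      unfolding eq
      by (rule integral_norm_le_const)
        (use unit_interval_step_approximation[OF _ _ n(1)] h sp in \<open>auto simp: u_def\<close>)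
    then show ?thesis using iu by simp
  qed
  have "\<bar>(\<Sum>j=1..n. measure M (B j)) / n - (\<Sum>j=1..n. measure M' (B j)) / n\<bar>
     = \<bar>\<Sum>j=1..n. measure M (B j) - measure M' (B j)\<bar> / n"
    by (simp add: sum_subtractf flip: diff_divide_distrib)
  also have "\<dots> \<le> (\<Sum>j=1..n. d) / n"
    using d B by (intro divide_right_mono order_trans[OF sum_abs] sum_mono) auto
  also have "\<dots> = d" using n by simp
  finally show "\<bar>(\<integral>x. h x \<partial>M) - (\<integral>x. h x \<partial>M')\<bar> \<le> d + e"
    using approx[OF M] approx[OF M'] n(2) by (simp add: abs_le_iff)
qed

text \<open>Subtracting the infimum and dividing by \<open>c\<close> moves \<open>g\<close> into the
  unit interval, and the subtracted constant has the same integral under both measures. The division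
  sets the case \<open>c = 0\<close> apart.\<close>

lemma integral_difference_le_oscillation:
  fixes g :: "'a \<Rightarrow> real"
  assumes M: "prob_space M" "sets M = sets S" and M': "prob_space M'" "sets M' = sets S"
    and d: "\<And>B. B \<in> sets S \<Longrightarrow> \<bar>measure M B - measure M' B\<bar> \<le> d"
    and g: "g \<in> borel_measurable S" "\<And>x y. x \<in> space S \<Longrightarrow> y \<in> space S \<Longrightarrow> \<bar>g x - g y\<bar> \<le> c"
  shows "\<bar>(\<integral>x. g x \<partial>M) - (\<integral>x. g x \<partial>M')\<bar> \<le> d * c"
proof -
  interpret M: prob_space M by fact
  interpret M': prob_space M' by fact
  have sp: "space M = space S" "space M' = space S"
    using sets_eq_imp_space_eq[OF M(2)] sets_eq_imp_space_eq[OF M'(2)] by simp_all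
  obtain x0 where x0: "x0 \<in> space S" using M.not_empty sp by auto
  define a where "a = (INF x\<in>space S. g x)"
  have bdd: "bdd_below (g ` space S)"
    by (rule bdd_belowI[of _ "g x0 - c"]) (use g(2)[OF x0] in \<open>fastforce simp: abs_le_iff\<close>)
  have a: "a \<le> g x" "g x \<le> a + c" if x: "x \<in> space S" for x
  proof -
    show "a \<le> g x" unfolding a_def by (rule cINF_lower[OF bdd x])
    have "g x - c \<le> a"
      unfolding a_def
    proof (rule cINF_greatest)
      show "g x - c \<le> g y" if "y \<in> space S" for y
        using g(2)[OF x that] by linarith
    qed (use x0 in auto)
    then show "g x \<le> a + c" by simp
  qed
  have c0: "0 \<le> c" using g(2)[OF x0 x0] by simp
  show ?thesis
  proof (cases "c = 0")
    case True
    have "g x = a" if "x \<in> space S" for x using a[OF that] True by simp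
    then have "(\<integral>x. g x \<partial>M) = (\<integral>x. a \<partial>M)" "(\<integral>x. g x \<partial>M') = (\<integral>x. a \<partial>M')"
      using sp by (metis Bochner_Integration.integral_cong)+
    then show ?thesis using True by (simp add: M.prob_space M'.prob_space)
  next
    case False
    then have c: "c > 0" using c0 by simp
    define h where "h x = (g x - a) / c" for x
    note [measurable] = g(1)
    have h: "\<bar>(\<integral>x. h x \<partial>M) - (\<integral>x. h x \<partial>M')\<bar> \<le> d"
    proof (rule integral_difference_unit[OF M M' d])
      show "h \<in> borel_measurable S" unfolding h_def by measurable
      show "0 \<le> h x \<and> h x \<le> 1" if "x \<in> space S" for x
        using a[OF that] c by (simp add: h_def)
    qed
    have bg: "bounded_measurable S g"
      by (rule bounded_measurableI[OF g(1), of "\<bar>a\<bar> + c"]) (use a in \<open>fastforce simp: abs_le_iff\<close>)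
    have ig: "integrable M g" "integrable M' g"
      using M.integrable_bounded_measurable[OF bg] M'.integrable_bounded_measurable[OF bg] M M' by auto
    have "(\<integral>x. h x \<partial>M) = ((\<integral>x. g x \<partial>M) - a) / c" "(\<integral>x. h x \<partial>M') = ((\<integral>x. g x \<partial>M') - a) / c"
      using ig by (simp_all add: h_def M.prob_space M'.prob_space)
    then have "(\<integral>x. h x \<partial>M) - (\<integral>x. h x \<partial>M') = ((\<integral>x. g x \<partial>M) - (\<integral>x. g x \<partial>M')) / c"
      by (simp add: diff_divide_distrib)
    then have "\<bar>(\<integral>x. g x \<partial>M) - (\<integral>x. g x \<partial>M')\<bar> / c \<le> d" using h c by simp
    then show ?thesis using c by (simp add: divide_le_eq)
  qed
qed

subsection \<open>Conditional moments of the tail sums\<close>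

text \<open>Contraction is assumed for exactly the kernels that enter
  \<open>min_ergodic_coeff\<close>. From time \<open>n\<close> on there is no summand left to start,
  so the backward recursions begin at \<open>n\<close> with value 0.\<close>

locale centered_row = path_chain S N \<nu> K
  for S :: "'a measure" and N \<nu> K +
  fixes n m :: nat and \<alpha> c :: real and Z :: "nat \<Rightarrow> (nat \<Rightarrow> 'a) \<Rightarrow> real"
  assumes N: "N = n + m"
    and \<alpha>: "0 < \<alpha>" "\<alpha> \<le> 1" and c: "0 < c"
    and contraction: "k \<in> {1..<n} \<Longrightarrow> u \<in> space S \<Longrightarrow> u' \<in> space S \<Longrightarrow> g \<in> borel_measurable S \<Longrightarrow>
        (\<And>y y'. y \<in> space S \<Longrightarrow> y' \<in> space S \<Longrightarrow> \<bar>g y - g y'\<bar> \<le> b) \<Longrightarrow>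
        \<bar>(\<integral>y. g y \<partial>K k u) - (\<integral>y. g y \<partial>K k u')\<bar> \<le> (1 - \<alpha>) * b"
    and Z_meas: "j \<in> {1..n} \<Longrightarrow> Z j \<in> borel_measurable paths"
    and Z_bound: "j \<in> {1..n} \<Longrightarrow> x \<in> space paths \<Longrightarrow> \<bar>Z j x\<bar> \<le> c"
    and Z_dep: "j \<in> {1..n} \<Longrightarrow> depends_on {j..j + m} (Z j)"
    and Z_mean: "j \<in> {1..n} \<Longrightarrow> x \<in> space paths \<Longrightarrow> E 0 (Z j) x = 0"
begin

lemma bounded_measurable_Z: "j \<in> {1..n} \<Longrightarrow> bounded_measurable paths (Z j)"
  using Z_meas Z_bound by (intro bounded_measurableI[of _ _ c]) auto

definition tail :: "nat \<Rightarrow> (nat \<Rightarrow> 'a) \<Rightarrow> real" where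
  "tail k x = (\<Sum>j\<in>{k<..n}. Z j x)"

lemma bounded_measurable_tail [intro!]: "bounded_measurable paths (tail k)"
  unfolding tail_def[abs_def] by (intro bounded_measurable_sum bounded_measurable_Z) auto

lemma tail_eq_0: "n \<le> k \<Longrightarrow> tail k = (\<lambda>_. 0)"
  by (simp add: tail_def[abs_def])

lemma tail_Suc: "k < n \<Longrightarrow> tail k x = Z (Suc k) x + tail (Suc k) x"
  unfolding tail_def
  by (subst sum.remove[of _ "Suc k"]) (auto intro!: arg_cong2[where f="(+)"] sum.cong)

lemma depends_on_tail: "depends_on {Suc k..N} (tail k)"
  unfolding tail_def[abs_def]
  by (intro depends_on_sum depends_on_mono[OF Z_dep]) (auto simp: N)

definition A :: real where "A = c / \<alpha>"

lemma A: "0 < A" "c \<le> A" "c = \<alpha> * A"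
  using \<alpha> c by (auto simp: A_def le_divide_eq mult_left_le)

text \<open>By the Markov property \<open>E (Suc k) H\<close> is a function of coordinate
  \<open>Suc k\<close> alone. Both sides therefore integrate the same function \<open>g\<close>,
  against the kernel started from \<open>x k\<close> and from \<open>x' k\<close>. At
  \<open>k = 0\<close> the two laws are equal.\<close>

lemma E_contraction:
  assumes k: "k < n" and H: "bounded_measurable paths H" "depends_on {Suc k..N} H"
    and osc: "\<And>x x'. x \<in> space paths \<Longrightarrow> x' \<in> space paths \<Longrightarrow> \<bar>E (Suc k) H x - E (Suc k) H x'\<bar> \<le> b"
    and x: "x \<in> space paths" "x' \<in> space paths"
  shows "\<bar>E k H x - E k H x'\<bar> \<le> (1 - \<alpha>) * b"
proof -
  have kN: "k < N" using k N by simp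
  define g where "g y = E (Suc k) H (x(Suc k := y))" for y
  have g: "bounded_measurable S g"
    unfolding g_def[abs_def]
    by (rule bounded_measurable_comp[OF bounded_measurable_E[OF H(1)] measurable_upd2[OF kN x(1)]])
  have dep: "depends_on {Suc k..Suc k} (E (Suc k) H)"
    by (rule depends_on_E[OF H]) (use kN in auto)
  have g': "E (Suc k) H (x'(Suc k := y)) = g y" if "y \<in> space S" for y
    unfolding g_def
    by (rule depends_onD[OF dep upd_in_paths[OF kN x(2) that] upd_in_paths[OF kN x(1) that]]) auto
  have Ex: "E k H x = (\<integral>y. g y \<partial>next_law k x)"
    unfolding g_def by (rule E_step[OF kN x(1) H(1)])
  have Ex': "E k H x' = (\<integral>y. g y \<partial>next_law k x')"
    unfolding E_step[OF kN x(2) H(1)] using g' next_law_prob(4)[OF kN x(2)]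
    by (intro Bochner_Integration.integral_cong) auto
  have b0: "0 \<le> b" using osc[OF x(1,1)] by simp
  show ?thesis
  proof (cases "k = 0")
    case True
    then show ?thesis using Ex Ex' b0 \<alpha> by (simp add: next_law_def)
  next
    case False
    have xk: "x k \<in> space S" "x' k \<in> space S"
      using x kN False by (auto simp: paths_def space_PiM PiE_iff)
    have "\<bar>(\<integral>y. g y \<partial>K k (x k)) - (\<integral>y. g y \<partial>K k (x' k))\<bar> \<le> (1 - \<alpha>) * b"
    proof (rule contraction[OF _ xk bounded_measurableD[OF g]])
      show "\<bar>g y - g y'\<bar> \<le> b" if "y \<in> space S" "y' \<in> space S" for y y'
        unfolding g_def using that upd_in_paths[OF kN x(1)] by (intro osc)
    qed (use k False in auto)
    then show ?thesis using Ex Ex' False by (simp add: next_law_def)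
  qed
qed

text \<open>A term of size \<open>b\<close> oscillates by at most \<open>2 * b\<close>, so the
  oscillation at \<open>k\<close> is at most \<open>1 - \<alpha>\<close> times the sum of
  \<open>2 * b\<close> and the one at \<open>Suc k\<close>. The value
  \<open>2 * b / \<alpha>\<close> reproduces itself, with a factor \<open>1 - \<alpha>^2\<close> to
  spare. Only the conditional mean of the newly added term has to be small, not the term
  itself.\<close>

lemma oscillation_backward:
  assumes H: "\<And>k. bounded_measurable paths (H k)" "\<And>k. depends_on {Suc k..N} (H k)"
    and Hn: "\<And>x. x \<in> space paths \<Longrightarrow> H n x = 0"
    and b: "\<And>k x. k < n \<Longrightarrow> x \<in> space paths \<Longrightarrow> \<bar>E (Suc k) (\<lambda>y. H k y - H (Suc k) y) x\<bar> \<le> b"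
    and b0: "0 \<le> b"
  shows "k \<le> n \<Longrightarrow> x \<in> space paths \<Longrightarrow> x' \<in> space paths \<Longrightarrow> \<bar>E k (H k) x - E k (H k) x'\<bar> \<le> 2 * b / \<alpha>"
proof (induction k arbitrary: x x' rule: inc_induct)
  case base
  have nN: "n \<le> N" using N by simp
  have "E n (H n) y = 0" if "y \<in> space paths" for y
    using cexp_cong[OF nN that, of "H n" "\<lambda>_. 0"] cexp_const[OF nN that, of 0] Hn by (simp add: E_eq_cexp)
  then show ?case using base b0 \<alpha> by simp
next
  case (step k)
  have kN: "Suc k \<le> N" using step N by simp
  have split: "E (Suc k) (H k) y = E (Suc k) (\<lambda>z. H k z - H (Suc k) z) y + E (Suc k) (H (Suc k)) y"
    if "y \<in> space paths" for y
    using kN that H by (simp add: E_eq_cexp cexp_diff)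
  have "\<bar>E k (H k) x - E k (H k) x'\<bar> \<le> (1 - \<alpha>) * (2 * b + 2 * b / \<alpha>)"
  proof (rule E_contraction[OF step.hyps(2) H])
    fix y y' assume y: "y \<in> space paths" "y' \<in> space paths"
    show "\<bar>E (Suc k) (H k) y - E (Suc k) (H k) y'\<bar> \<le> 2 * b + 2 * b / \<alpha>"
      using split[OF y(1)] split[OF y(2)] b[OF step.hyps(2) y(1)] b[OF step.hyps(2) y(2)] step.IH[OF y]
      by linarith
  qed fact+
  also have "\<dots> = (1 - \<alpha>\<^sup>2) * (2 * b / \<alpha>)"
    using \<alpha> by (simp add: field_simps power2_eq_square)
  also have "\<dots> \<le> 1 * (2 * b / \<alpha>)"
    using \<alpha> b0 by (intro mult_right_mono) auto
  finally show ?case by simp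
qed

lemma E_bound:
  assumes "k \<le> N" "x \<in> space paths" "\<And>y. y \<in> space paths \<Longrightarrow> \<bar>H y\<bar> \<le> b"
  shows "\<bar>E k H x\<bar> \<le> b"
  using cexp_bound[OF assms(1,2), of H b] assms(3) by (simp add: E_eq_cexp)

lemma tail_oscillation:
  assumes k: "k \<le> N" and x: "x \<in> space paths" "x' \<in> space paths"
  shows "\<bar>E k (tail k) x - E k (tail k) x'\<bar> \<le> 2 * A"
proof (cases "k \<le> n")
  case True
  have "\<bar>E k (tail k) x - E k (tail k) x'\<bar> \<le> 2 * c / \<alpha>"
  proof (rule oscillation_backward[OF bounded_measurable_tail depends_on_tail _ _ _ True x])
    fix k x assume kx: "k < n" "x \<in> space paths"
    then show "\<bar>E (Suc k) (\<lambda>y. tail k y - tail (Suc k) y) x\<bar> \<le> c"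
      using Z_bound by (intro E_bound) (auto simp: tail_Suc N)
  qed (use c tail_eq_0 in auto)
  then show ?thesis by (simp add: A_def)
next
  case False
  then show ?thesis using A(1) by (simp add: tail_eq_0 E_def)
qed

text \<open>The conditional mean has expectation 0, so its size is at most its oscillation.\<close>

lemma tail_mean_bound:
  assumes k: "k \<le> N" and x: "x \<in> space paths"
  shows "\<bar>E k (tail k) x\<bar> \<le> 2 * A"
proof -
  have "cexp 0 (E k (tail k)) x = cexp 0 (tail k) x"
    using E_tower[OF bounded_measurable_tail k _ x] by (simp add: E_eq_cexp)
  also have "\<dots> = 0"
    unfolding tail_def[abs_def] using x Z_mean bounded_measurable_Z
    by (subst cexp_sum) (auto simp: E_eq_cexp)
  finally have 0: "cexp 0 (E k (tail k)) x = 0" .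
  have "cexp 0 (\<lambda>y. E k (tail k) y - E k (tail k) x) x = - E k (tail k) x"
    using x 0 by (subst cexp_diff) (auto simp: cexp_const)
  moreover have "norm (cexp 0 (\<lambda>y. E k (tail k) y - E k (tail k) x) x) \<le> 2 * A"
    by (rule cexp_bound) (use x tail_oscillation[OF k] in auto)
  ultimately show ?thesis by simp
qed

text \<open>Only the \<open>m\<close> summands after time \<open>k\<close> interact with \<open>B\<close>; the remaining tail enters through its
  bounded conditional mean.\<close>

lemma cross_term_bound:
  assumes k: "k \<le> N" and x: "x \<in> space paths" and B: "bounded_measurable paths B" "depends_on {1..k + m} B"
    and b: "\<And>y. y \<in> space paths \<Longrightarrow> \<bar>B y\<bar> \<le> b"
  shows "\<bar>E k (\<lambda>y. B y * tail k y) x\<bar> \<le> b * (m * c + 2 * A)"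
proof -
  \<comment> \<open>At time \<open>l\<close> the factor \<open>B\<close> is known and can be pulled
    out; the cap is there because conditioning ends at \<open>N\<close>.\<close>
  define l where "l = min (k + m) N"
  have l: "k \<le> l" "l \<le> N" "l \<le> k + m" using k by (auto simp: l_def)
  have depB: "depends_on {1..l} B"
    using B(2) depends_on_all[of B] by (cases "k + m \<le> N") (auto simp: l_def min_def)
  have b0: "0 \<le> b" using b[OF x] by simp
  have near: "\<bar>tail k y - tail l y\<bar> \<le> m * c" if y: "y \<in> space paths" for y
  proof -
    have "tail k y - tail l y = (\<Sum>j\<in>{k<..n} - {l<..n}. Z j y)"
      unfolding tail_def using l by (subst sum_diff) auto
    also have "\<bar>\<dots>\<bar> \<le> (\<Sum>j\<in>{k<..n} - {l<..n}. c)"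
      using y by (intro order_trans[OF sum_abs] sum_mono Z_bound) auto
    also have "\<dots> = card ({k<..n} - {l<..n}) * c" by simp
    also have "\<dots> \<le> m * c"
    proof (intro mult_right_mono)
      have "card ({k<..n} - {l<..n}) \<le> card {k<..l}" by (intro card_mono) auto
      then show "real (card ({k<..n} - {l<..n})) \<le> real m" using l by simp
    qed (use c in simp)
    finally show ?thesis .
  qed
  have 1: "\<bar>E k (\<lambda>y. B y * (tail k y - tail l y)) x\<bar> \<le> b * (m * c)"
    by (rule E_bound[OF k x]) (use b near b0 in \<open>auto simp: abs_mult intro!: mult_mono\<close>)
  have 2: "\<bar>E k (E l (\<lambda>y. B y * tail l y)) x\<bar> \<le> b * (2 * A)"
  proof (rule E_bound[OF k x])
    fix y assume y: "y \<in> space paths"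
    show "\<bar>E l (\<lambda>y. B y * tail l y) y\<bar> \<le> b * (2 * A)"
      using E_pullout[OF B(1) bounded_measurable_tail l(2) depB y] b[OF y] tail_mean_bound[OF l(2) y] b0
      by (auto simp: abs_mult intro!: mult_mono)
  qed
  have "E k (\<lambda>y. B y * tail k y) x = E k (\<lambda>y. B y * (tail k y - tail l y) + B y * tail l y) x"
    by (simp add: algebra_simps)
  also have "\<dots> = E k (\<lambda>y. B y * (tail k y - tail l y)) x + E k (\<lambda>y. B y * tail l y) x"
    unfolding E_eq_cexp using k x B(1) by (intro cexp_add) auto
  also have "E k (\<lambda>y. B y * tail l y) x = E k (E l (\<lambda>y. B y * tail l y)) x"
    by (rule E_tower[symmetric]) (use l x B(1) in auto)
  finally show ?thesis using 1 2 by (simp add: algebra_simps)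
qed

lemma tail_square_oscillation:
  assumes k: "k \<le> N" and x: "x \<in> space paths" "x' \<in> space paths"
  shows "\<bar>E k (\<lambda>y. (tail k y)\<^sup>2) x - E k (\<lambda>y. (tail k y)\<^sup>2) x'\<bar> \<le> (4 * m + 10) * A\<^sup>2"
proof (cases "k \<le> n")
  case True
  \<comment> \<open>The bound for the conditional mean of \<open>Z^2 + 2 * Z * tail\<close>, which
    is what the square of the tail gains in one step.\<close>
  define b where "b = c\<^sup>2 + 2 * (c * (m * c + 2 * A))"
  have b0: "0 \<le> b" using c A(1) by (simp add: b_def)
  have "\<bar>E k (\<lambda>y. (tail k y)\<^sup>2) x - E k (\<lambda>y. (tail k y)\<^sup>2) x'\<bar> \<le> 2 * b / \<alpha>"
  proof (rule oscillation_backward[OF _ _ _ _ b0 True x])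
    show "depends_on {Suc k..N} (\<lambda>y. (tail k y)\<^sup>2)" for k
      by (rule depends_on_comp[OF depends_on_tail])
    fix k x assume kx: "k < n" "x \<in> space paths"
    have j: "Suc k \<in> {1..n}" and kN: "Suc k \<le> N" using kx N by auto
    note bZ = bounded_measurable_Z[OF j]
    have eq: "(tail k y)\<^sup>2 - (tail (Suc k) y)\<^sup>2 = (Z (Suc k) y)\<^sup>2 + 2 * (Z (Suc k) y * tail (Suc k) y)" for y
      using kx by (simp add: tail_Suc power2_sum)
    have "E (Suc k) (\<lambda>y. (tail k y)\<^sup>2 - (tail (Suc k) y)\<^sup>2) x
        = E (Suc k) (\<lambda>y. (Z (Suc k) y)\<^sup>2) x + 2 * E (Suc k) (\<lambda>y. Z (Suc k) y * tail (Suc k) y) x"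
      unfolding E_eq_cexp eq using kN kx bZ by (subst cexp_add) (auto simp: cexp_cmult)
    moreover have "\<bar>E (Suc k) (\<lambda>y. (Z (Suc k) y)\<^sup>2) x\<bar> \<le> c\<^sup>2"
      using kN kx Z_bound[OF j] c by (intro E_bound) (auto intro!: power2_le_iff_abs_le[THEN iffD2])
    \<comment> \<open>\<open>Z (Suc k)\<close> looks as far as \<open>Suc k + m\<close>, so it
      cannot simply be taken out at time \<open>Suc k\<close>.\<close>
    moreover have "\<bar>E (Suc k) (\<lambda>y. Z (Suc k) y * tail (Suc k) y) x\<bar> \<le> c * (m * c + 2 * A)"
    proof (rule cross_term_bound[OF kN kx(2) bZ])
      show "depends_on {1..Suc k + m} (Z (Suc k))" by (rule depends_on_mono[OF Z_dep[OF j]]) auto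
    qed (rule Z_bound[OF j])
    ultimately show "\<bar>E (Suc k) (\<lambda>y. (tail k y)\<^sup>2 - (tail (Suc k) y)\<^sup>2) x\<bar> \<le> b"
      unfolding b_def by linarith
  qed (auto simp: tail_eq_0)
  also have "2 * b / \<alpha> = 2 * (c * A + 2 * (A * (m * c + 2 * A)))"
    using \<alpha> by (simp add: b_def A_def field_simps power2_eq_square)
  also have "\<dots> \<le> 2 * (A * A + 2 * (A * (m * A + 2 * A)))"
    using A by (intro mult_left_mono add_mono mult_right_mono) auto
  also have "\<dots> = (4 * m + 10) * A\<^sup>2" by (simp add: algebra_simps power2_eq_square)
  finally show ?thesis .
next
  case False
  then show ?thesis using A(1) by (simp add: tail_eq_0 E_def)
qed

lemma cvar_add_past:
  assumes k: "k \<le> N" and x: "x \<in> space paths" and P: "bounded_measurable paths P" "depends_on {1..k} P"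
    and R: "bounded_measurable paths R"
  shows "cvar k (\<lambda>y. P y + R y) x = cvar k R x"
proof -
  have PP: "cexp k (\<lambda>y. (P y)\<^sup>2) x = (P x)\<^sup>2" "cexp k P x = P x"
    using E_of_past[OF k x bounded_measurable_power[OF P(1)] depends_on_comp[OF P(2), of "\<lambda>z. z\<^sup>2"]]
      E_of_past[OF k x P] by (simp_all add: E_eq_cexp)
  have PR: "cexp k (\<lambda>y. P y * R y) x = P x * cexp k R x"
    using E_pullout[OF P(1) R k P(2) x] by (simp add: E_eq_cexp)
  have "cexp k (\<lambda>y. (P y + R y)\<^sup>2) x = cexp k (\<lambda>y. (P y)\<^sup>2 + (R y)\<^sup>2 + 2 * (P y * R y)) x"
    by (simp add: power2_sum algebra_simps)
  also have "\<dots> = (P x)\<^sup>2 + cexp k (\<lambda>y. (R y)\<^sup>2) x + 2 * (P x * cexp k R x)"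
    using P(1) R by (simp add: cexp_add[OF k x] cexp_cmult[OF k x] PP PR bounded_measurable_add
        bounded_measurable_mult bounded_measurable_power)
  finally show ?thesis
    using P(1) R by (simp add: cvar_def cexp_add[OF k x] PP power2_sum)
qed

section \<open>Splitting the row sum at a conditioning time\<close>

definition finished :: "nat \<Rightarrow> (nat \<Rightarrow> 'a) \<Rightarrow> real" where
  "finished k x = (\<Sum>j\<in>{j\<in>{1..n}. j + m \<le> k}. Z j x)"

text \<open>The summands that are neither determined at time \<open>k\<close> nor part of
  \<open>tail l\<close>. The case \<open>l = k\<close> serves the conditional variance and has at
  most \<open>m\<close> summands; \<open>l = Suc k\<close> serves the increments and has at most
  \<open>m + 1\<close>.\<close>

definition current :: "nat \<Rightarrow> nat \<Rightarrow> (nat \<Rightarrow> 'a) \<Rightarrow> real" where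
  "current k l x = (\<Sum>j\<in>{j\<in>{1..n}. k < j + m \<and> j \<le> l}. Z j x)"

lemma bounded_measurable_finished [intro!]: "bounded_measurable paths (finished k)"
  and bounded_measurable_current [intro!]: "bounded_measurable paths (current k l)"
  unfolding finished_def[abs_def] current_def[abs_def]
  by (intro bounded_measurable_sum bounded_measurable_Z; simp)+

lemma depends_on_finished: "depends_on {1..k} (finished k)"
  and depends_on_current: "depends_on {1..l + m} (current k l)"
  unfolding finished_def[abs_def] current_def[abs_def]
  by (intro depends_on_sum depends_on_mono[OF Z_dep]; auto)+

lemma split_row: "k \<le> l \<Longrightarrow> tail 0 x = finished k x + (current k l x + tail l x)"
proof -
  assume kl: "k \<le> l"
  have "{0<..n} = {j\<in>{1..n}. j + m \<le> k} \<union> ({j\<in>{1..n}. k < j + m \<and> j \<le> l} \<union> {l<..n})"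
    using kl by auto
  then show ?thesis
    unfolding tail_def finished_def current_def using kl
    by (subst \<open>{0<..n} = _\<close>, subst sum.union_disjoint, simp, simp, force, subst sum.union_disjoint) auto
qed

lemma current_bound:
  assumes "k \<le> l" "x \<in> space paths"
  shows "\<bar>current k l x\<bar> \<le> (m + (l - k)) * c"
proof -
  have "\<bar>current k l x\<bar> \<le> (\<Sum>j\<in>{j\<in>{1..n}. k < j + m \<and> j \<le> l}. c)"
    unfolding current_def using assms(2) by (intro order_trans[OF sum_abs] sum_mono Z_bound) auto
  also have "\<dots> = card {j\<in>{1..n}. k < j + m \<and> j \<le> l} * c" by simp
  also have "\<dots> \<le> (m + (l - k)) * c"
  proof (intro mult_right_mono)
    have "card {j\<in>{1..n}. k < j + m \<and> j \<le> l} \<le> card {Suc k..<Suc l + m}"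
      by (rule card_inj_on_le[of "\<lambda>j. j + m"]) (auto simp: inj_on_def)
    then show "real (card {j\<in>{1..n}. k < j + m \<and> j \<le> l}) \<le> real (m + (l - k))"
      using assms(1) by (simp del: of_nat_add)
  qed (use c in simp)
  finally show ?thesis .
qed

text \<open>The finished summands do not affect the conditional variance. What then separates it
  from the conditional second moment of the tail involves only the partly revealed summands and the
  conditional mean of the tail, each of order \<open>A\<close>.\<close>

lemma cvar_oscillation:
  assumes k: "k \<le> N" and x: "x \<in> space paths" "x' \<in> space paths"
  shows "\<bar>cvar k (tail 0) x - cvar k (tail 0) x'\<bar> \<le> (5 * (m + 1) * A)\<^sup>2"
proof -
  have near: "\<bar>cvar k (tail 0) x - E k (\<lambda>y. (tail k y)\<^sup>2) x\<bar> \<le> (2 * (m + 1) * A)\<^sup>2"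
    if x: "x \<in> space paths" for x
  proof -
    let ?B = "current k k"
    have mc: "0 \<le> m * c" "m * c \<le> m * A" using c A by (auto intro: mult_left_mono)
    have "tail 0 = (\<lambda>y. finished k y + (?B y + tail k y))"
      by (rule ext, rule split_row) simp
    then have "cvar k (tail 0) x = cvar k (\<lambda>y. ?B y + tail k y) x"
      using cvar_add_past[OF k x bounded_measurable_finished depends_on_finished, of "\<lambda>y. ?B y + tail k y"] by auto
    also have "\<dots> = cexp k (\<lambda>y. (?B y)\<^sup>2 + (tail k y)\<^sup>2 + 2 * (?B y * tail k y)) x - (cexp k ?B x + cexp k (tail k) x)\<^sup>2"
      unfolding cvar_def cexp_add[OF k x bounded_measurable_current bounded_measurable_tail]
      by (simp add: power2_sum algebra_simps)
    also have "cexp k (\<lambda>y. (?B y)\<^sup>2 + (tail k y)\<^sup>2 + 2 * (?B y * tail k y)) x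
        = cexp k (\<lambda>y. (?B y)\<^sup>2) x + cexp k (\<lambda>y. (tail k y)\<^sup>2) x + 2 * cexp k (\<lambda>y. ?B y * tail k y) x"
      using k x by (subst cexp_add, auto)+ (auto simp: cexp_cmult)
    finally have eq: "cvar k (tail 0) x - E k (\<lambda>y. (tail k y)\<^sup>2) x
      = E k (\<lambda>y. (?B y)\<^sup>2) x + 2 * E k (\<lambda>y. ?B y * tail k y) x - (E k ?B x + E k (tail k) x)\<^sup>2"
      by (simp add: E_eq_cexp)
    have Bb: "\<bar>?B y\<bar> \<le> m * A" if "y \<in> space paths" for y
      using current_bound[OF order_refl that, of k] mc by simp
    have 1: "\<bar>E k (\<lambda>y. (?B y)\<^sup>2) x\<bar> \<le> (m * A)\<^sup>2"
      by (rule E_bound[OF k x]) (use Bb A(1) in \<open>auto simp: abs_le_square_iff[symmetric]\<close>)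
    have "\<bar>E k (\<lambda>y. ?B y * tail k y) x\<bar> \<le> m * A * (m * c + 2 * A)"
      by (rule cross_term_bound[OF k x bounded_measurable_current depends_on_current Bb])
    also have "\<dots> \<le> m * A * (m * A + 2 * A)"
      using mc A(1) by (intro mult_left_mono) auto
    finally have 2: "\<bar>E k (\<lambda>y. ?B y * tail k y) x\<bar> \<le> m * A * (m * A + 2 * A)" .
    have "\<bar>E k ?B x + E k (tail k) x\<bar> \<le> m * A + 2 * A"
      using E_bound[OF k x, of ?B, OF Bb] tail_mean_bound[OF k x] by linarith
    then have 3: "(E k ?B x + E k (tail k) x)\<^sup>2 \<le> (m * A + 2 * A)\<^sup>2"
      using A(1) by (subst abs_le_square_iff[symmetric]) auto
    have "\<bar>cvar k (tail 0) x - E k (\<lambda>y. (tail k y)\<^sup>2) x\<bar>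
      \<le> (m * A)\<^sup>2 + 2 * (m * A * (m * A + 2 * A)) + (m * A + 2 * A)\<^sup>2"
      unfolding eq using 1 2 3 zero_le_power2[of "E k ?B x + E k (tail k) x"] by linarith
    \<comment> \<open>The sum is the square of \<open>m * A + (m * A + 2 * A)\<close>.\<close>
    also have "\<dots> = (2 * (m + 1) * A)\<^sup>2"
      by (simp add: power2_eq_square algebra_simps)
    finally show ?thesis .
  qed
  have "\<bar>cvar k (tail 0) x - cvar k (tail 0) x'\<bar> \<le> 2 * (2 * (m + 1) * A)\<^sup>2 + (4 * m + 10) * A\<^sup>2"
    using near[OF x(1)] near[OF x(2)] tail_square_oscillation[OF k x] by linarith
  also have "\<dots> = (8 * (real m)\<^sup>2 + 20 * m + 18) * A\<^sup>2"
    by (simp add: power2_eq_square algebra_simps)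
  \<comment> \<open>Rounded up to a perfect square whose root also bounds the increments, so that a
    single \<open>e\<close> serves both.\<close>
  also have "\<dots> \<le> (25 * (real m)\<^sup>2 + 50 * m + 25) * A\<^sup>2"
    by (intro mult_right_mono add_mono) auto
  also have "\<dots> = (5 * (m + 1) * A)\<^sup>2"
    by (simp add: power2_eq_square algebra_simps)
  finally show ?thesis .
qed

text \<open>Changing coordinate \<open>Suc k\<close> leaves \<open>finished k\<close> alone. It
  moves the at most \<open>m + 1\<close> current summands, by \<open>2 * c\<close> each at most, and
  the conditional mean of the tail, by its oscillation \<open>2 * A\<close>.\<close>

lemma AE_row_increment:
  assumes k: "k < N" and x: "x \<in> space paths"
  shows "AE z in path_law k x. \<bar>E (Suc k) (tail 0) z - E k (tail 0) x\<bar> \<le> 5 * (m + 1) * A"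
proof (rule AE_increment[OF k x bounded_measurable_tail])
  fix y y' assume y: "y \<in> space S" "y' \<in> space S"
  let ?u = "x(Suc k := y)" and ?u' = "x(Suc k := y')" and ?B = "current k (Suc k)"
  have u: "?u \<in> space paths" "?u' \<in> space paths" using upd_in_paths[OF k x] y by auto
  have kN: "Suc k \<le> N" using k by simp
  have dep: "depends_on {1..Suc k} (finished k)"
    by (rule depends_on_mono[OF depends_on_finished]) auto
  have split: "E (Suc k) (tail 0) v = finished k v + (E (Suc k) ?B v + E (Suc k) (tail (Suc k)) v)"
    if v: "v \<in> space paths" for v
  proof -
    have "tail 0 = (\<lambda>y. finished k y + (?B y + tail (Suc k) y))"
      by (rule ext, rule split_row) simp
    then have "E (Suc k) (tail 0) v = cexp (Suc k) (\<lambda>y. finished k y + (?B y + tail (Suc k) y)) v"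
      by (simp only: E_eq_cexp)
    also have "\<dots> = cexp (Suc k) (finished k) v + cexp (Suc k) (\<lambda>y. ?B y + tail (Suc k) y) v"
      by (intro cexp_add[OF kN v]) auto
    also have "cexp (Suc k) (\<lambda>y. ?B y + tail (Suc k) y) v = cexp (Suc k) ?B v + cexp (Suc k) (tail (Suc k)) v"
      by (intro cexp_add[OF kN v]) auto
    finally have "E (Suc k) (tail 0) v = E (Suc k) (finished k) v + (E (Suc k) ?B v + E (Suc k) (tail (Suc k)) v)"
      by (simp only: E_eq_cexp)
    then show ?thesis using E_of_past[OF kN v _ dep] by auto
  qed
  have same: "finished k ?u = finished k ?u'"
    by (rule depends_onD[OF depends_on_finished u]) auto
  have B: "\<bar>E (Suc k) ?B v\<bar> \<le> (m + 1) * c" if "v \<in> space paths" for v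
    by (rule E_bound[OF kN that]) (use current_bound[of k "Suc k"] in auto)
  have "\<bar>E (Suc k) (tail 0) ?u - E (Suc k) (tail 0) ?u'\<bar> \<le> 2 * ((m + 1) * c) + 2 * A"
    using split[OF u(1)] split[OF u(2)] same B[OF u(1)] B[OF u(2)] tail_oscillation[OF kN u] by linarith
  also have "\<dots> \<le> 2 * ((m + 1) * A) + 2 * A"
    using A by (intro add_right_mono mult_left_mono) auto
  also have "\<dots> \<le> 5 * (m + 1) * A"
    using A(1) by (simp add: algebra_simps)
  finally show "\<bar>E (Suc k) (tail 0) ?u - E (Suc k) (tail 0) ?u'\<bar> \<le> 5 * (m + 1) * A" .
qed

theorem row_char_near_gaussian:
  fixes t :: real
  defines "e \<equiv> 5 * (m + 1) * (c / \<alpha>)"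
  defines "q \<equiv> \<bar>t\<bar> * e + 3 / 2 * t\<^sup>2 * e\<^sup>2"
  assumes x0: "x0 \<in> space paths" and q: "q \<le> 1"
    and var: "\<And>x. x \<in> space paths \<Longrightarrow> E 0 (\<lambda>y. (tail 0 y)\<^sup>2) x = 1"
  shows "norm (cexp 0 (\<lambda>y. exp (\<i> * of_real (t * tail 0 y))) x0 - of_real (exp (- t\<^sup>2 / 2)))
    \<le> (\<bar>t\<bar> ^ 3 * e / 4 + 4 * q * t\<^sup>2) + (\<bar>t\<bar> ^ 3 / (4 * e) + t ^ 4 / 8 + q * t ^ 4) * (3 * e\<^sup>2)"
  unfolding q_def
proof (rule char_near_gaussian[OF bounded_measurable_tail x0])
  show "0 < e" unfolding e_def using c \<alpha> by (intro mult_pos_pos divide_pos_pos) auto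
  show "\<bar>t\<bar> * e + 3 / 2 * t\<^sup>2 * e\<^sup>2 \<le> 1" using q by (simp add: q_def)
  show "cexp 0 (tail 0) x = 0" if "x \<in> space paths" for x
    unfolding tail_def[abs_def] using that Z_mean bounded_measurable_Z
    by (subst cexp_sum) (auto simp: E_eq_cexp)
  show "cexp 0 (\<lambda>y. (tail 0 y)\<^sup>2) x = 1" if "x \<in> space paths" for x
    using var[OF that] by (simp add: E_eq_cexp)
  show "AE y in path_law k x. \<bar>cexp (Suc k) (tail 0) y - cexp k (tail 0) x\<bar> \<le> e"
    if "k < N" "x \<in> space paths" for k x
    using AE_row_increment[OF that] by (simp add: E_eq_cexp e_def A_def)
  show "\<bar>cvar k (tail 0) x - cvar k (tail 0) y\<bar> \<le> e\<^sup>2"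
    if "k \<le> N" "x \<in> space paths" "y \<in> space paths" for k x y
    using cvar_oscillation[OF that] by (simp add: e_def A_def)
qed

end

subsection \<open>The law of the trajectory\<close>

locale realized_chain = path_chain S N \<nu> K
  for S :: "'a measure" and N \<nu> K +
  fixes P :: "'w measure" and X :: "nat \<Rightarrow> 'w \<Rightarrow> 'a"
  assumes chain: "markov_chain P S N K X"
    and N_pos: "1 \<le> N"
    and initial_law: "\<nu> = distr P S (X 1)"
begin

sublocale P: prob_space P using chain by (simp add: markov_chain_def)

lemma X_meas: "i \<in> {1..N} \<Longrightarrow> X i \<in> P \<rightarrow>\<^sub>M S"
  using chain by (simp add: markov_chain_def)

definition trajectory :: "'w \<Rightarrow> nat \<Rightarrow> 'a" where
  "trajectory \<omega> = (\<lambda>j\<in>{1..N}. X j \<omega>)"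

lemma trajectory_meas: "trajectory \<in> P \<rightarrow>\<^sub>M paths"
  unfolding trajectory_def[abs_def] paths_def by (intro measurable_restrict X_meas)

lemma trajectory_space: "\<omega> \<in> space P \<Longrightarrow> trajectory \<omega> \<in> space paths"
  using trajectory_meas measurable_space by metis

section \<open>The joint law of the past and the next state\<close>

context
  fixes k assumes k: "k \<in> {1..<N}"
begin

abbreviation pasts :: "(nat \<Rightarrow> 'a) measure" where "pasts \<equiv> Pi\<^sub>M {1..k} (\<lambda>_. S)"

definition history :: "'w \<Rightarrow> nat \<Rightarrow> 'a" where "history \<omega> = (\<lambda>j\<in>{1..k}. X j \<omega>)"

lemma history_meas: "history \<in> P \<rightarrow>\<^sub>M pasts"
  unfolding history_def[abs_def] using k by (intro measurable_restrict X_meas) auto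

text \<open>The conditional expectation in \<open>markov_chain\<close> enters here, through its
  defining identity on the event \<open>F\<close> of the past.\<close>

lemma markov_rectangle:
  assumes A: "A \<in> sets pasts" and B: "B \<in> sets S"
  shows "(\<integral>\<omega>. indicator A (history \<omega>) * indicator B (X (Suc k) \<omega>) \<partial>P)
    = (\<integral>\<omega>. indicator A (history \<omega>) * measure (K k (X k \<omega>)) B \<partial>P)"
proof -
  have sub: "subalgebra P (past P S X k)"
    unfolding subalgebra_def past_def
    using sets_image_in_sets[OF refl history_meas] by (simp add: history_def[abs_def])
  interpret finite_measure_subalgebra P "past P S X k"
    by unfold_locales (rule sub)
  note [measurable] = X_meas[of "Suc k"] B
  have Xk [measurable]: "X (Suc k) \<in> P \<rightarrow>\<^sub>M S" using k by (intro X_meas) auto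
  define F where "F = history -` A \<inter> space P"
  have F: "F \<in> sets (past P S X k)"
    unfolding F_def past_def using in_vimage_algebra[OF A] by (simp add: history_def[abs_def])
  have FP: "F \<in> sets P" using F sub by (auto simp: subalgebra_def)
  have int: "integrable P (\<lambda>\<omega>. indicator B (X (Suc k) \<omega>) :: real)"
    by (rule P.integrable_const_bound[of _ 1]) (auto simp: indicator_def)
  have ae: "AE \<omega> in P. real_cond_exp P (past P S X k) (\<lambda>\<omega>. indicator B (X (Suc k) \<omega>)) \<omega>
          = measure (K k (X k \<omega>)) B"
    using chain k B by (simp add: markov_chain_def)
  have ind: "indicator F \<omega> = (indicator A (history \<omega>) :: real)" if "\<omega> \<in> space P" for \<omega>
    using that by (simp add: F_def indicator_def)
  have "(\<integral>\<omega>. indicator A (history \<omega>) * indicator B (X (Suc k) \<omega>) \<partial>P)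
      = (\<integral>\<omega>\<in>F. (indicator B (X (Suc k) \<omega>) :: real) \<partial>P)"
    unfolding set_lebesgue_integral_def using ind by (intro Bochner_Integration.integral_cong) auto
  also have "\<dots> = (\<integral>\<omega>\<in>F. real_cond_exp P (past P S X k) (\<lambda>\<omega>. indicator B (X (Suc k) \<omega>)) \<omega> \<partial>P)"
    by (rule real_cond_exp_intA[OF int F])
  also have "\<dots> = (\<integral>\<omega>. indicator A (history \<omega>) * measure (K k (X k \<omega>)) B \<partial>P)"
    unfolding set_lebesgue_integral_def
  proof (rule integral_cong_AE)
    have Xk0: "X k \<in> P \<rightarrow>\<^sub>M S" using k by (intro X_meas) auto
    have "(\<lambda>x. measure (K k x) B) \<in> borel_measurable S"
      using measurable_prob_algebraD[OF K[OF k]] B by measurable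
    then have [measurable]: "(\<lambda>\<omega>. measure (K k (X k \<omega>)) B) \<in> borel_measurable P"
      by (rule measurable_compose[OF Xk0])
    note [measurable] = history_meas A FP
    show "(\<lambda>\<omega>. indicator A (history \<omega>) * measure (K k (X k \<omega>)) B) \<in> borel_measurable P"
      by measurable
    show "(\<lambda>\<omega>. indicator F \<omega> *\<^sub>R real_cond_exp P (past P S X k) (\<lambda>\<omega>. indicator B (X (Suc k) \<omega>)) \<omega>) \<in> borel_measurable P"
      by measurable
    show "AE \<omega> in P. indicator F \<omega> *\<^sub>R real_cond_exp P (past P S X k) (\<lambda>\<omega>. indicator B (X (Suc k) \<omega>)) \<omega>
        = indicator A (history \<omega>) * measure (K k (X k \<omega>)) B"
      using ae AE_space by eventually_elim (use ind in auto)
  qed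
  finally show ?thesis .
qed

text \<open>The point mass at \<open>u\<close> times the kernel \<open>K k (u k)\<close>: keeping
  the history makes the joint law a single bind.\<close>

definition next_kernel :: "(nat \<Rightarrow> 'a) \<Rightarrow> ((nat \<Rightarrow> 'a) \<times> 'a) measure" where
  "next_kernel u = K k (u k) \<bind> (\<lambda>y. return (pasts \<Otimes>\<^sub>M S) (u, y))"

lemma K_past_meas: "(\<lambda>u. K k (u k)) \<in> pasts \<rightarrow>\<^sub>M prob_algebra S"
  using K[OF k] k by (intro measurable_compose[OF measurable_component_singleton]) auto

lemma next_kernel_meas: "next_kernel \<in> pasts \<rightarrow>\<^sub>M prob_algebra (pasts \<Otimes>\<^sub>M S)"
proof -
  have "(\<lambda>(u, y). return (pasts \<Otimes>\<^sub>M S) (u, y)) \<in> pasts \<Otimes>\<^sub>M S \<rightarrow>\<^sub>M prob_algebra (pasts \<Otimes>\<^sub>M S)"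
    using measurable_return_prob_space by (simp add: case_prod_beta')
  then show ?thesis
    unfolding next_kernel_def[abs_def] by (rule measurable_bind_prob_space2[OF K_past_meas])
qed

lemma integral_next_kernel:
  fixes \<phi> :: "_ \<Rightarrow> real"
  assumes \<phi>: "bounded_measurable (pasts \<Otimes>\<^sub>M S) \<phi>"
  shows "(\<integral>z. \<phi> z \<partial>(distr P pasts history \<bind> next_kernel))
     = (\<integral>\<omega>. (\<integral>y. \<phi> (history \<omega>, y) \<partial>K k (X k \<omega>)) \<partial>P)"
proof -
  have law: "distr P pasts history \<in> space (prob_algebra pasts)"
    using P.prob_space_distr[OF history_meas] by (simp add: space_prob_algebra)
  have inner: "(\<integral>z. \<phi> z \<partial>next_kernel u) = (\<integral>y. \<phi> (u, y) \<partial>K k (u k))" if u: "u \<in> space pasts" for u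
  proof -
    have Ku: "K k (u k) \<in> space (prob_algebra S)" using measurable_space[OF K_past_meas u] .
    have sp: "space (K k (u k)) = space S"
      using Ku sets_eq_imp_space_eq by (auto simp: space_prob_algebra)
    have "(\<integral>z. \<phi> z \<partial>next_kernel u) = (\<integral>y. (\<integral>z. \<phi> z \<partial>return (pasts \<Otimes>\<^sub>M S) (u, y)) \<partial>K k (u k))"
      unfolding next_kernel_def
      by (rule integral_bind_bounded_measurable[OF Ku _ \<phi>])
        (rule measurable_compose[OF measurable_Pair1'[OF u] measurable_return_prob_space])
    also have "\<dots> = (\<integral>y. \<phi> (u, y) \<partial>K k (u k))"
      using \<phi> u sp by (intro Bochner_Integration.integral_cong)
        (auto simp: integral_return space_pair_measure bounded_measurableD)
    finally show ?thesis .
  qed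
  have "(\<integral>z. \<phi> z \<partial>(distr P pasts history \<bind> next_kernel))
     = (\<integral>u. (\<integral>z. \<phi> z \<partial>next_kernel u) \<partial>distr P pasts history)"
    by (rule integral_bind_bounded_measurable[OF law next_kernel_meas \<phi>])
  also have "\<dots> = (\<integral>\<omega>. (\<integral>z. \<phi> z \<partial>next_kernel (history \<omega>)) \<partial>P)"
    by (rule integral_distr[OF history_meas])
      (rule measurable_compose[OF measurable_prob_algebraD[OF next_kernel_meas]
          integral_measurable_subprob_algebra[OF bounded_measurableD[OF \<phi>]]])
  also have "\<dots> = (\<integral>\<omega>. (\<integral>y. \<phi> (history \<omega>, y) \<partial>K k (X k \<omega>)) \<partial>P)"
    using inner measurable_space[OF history_meas] k
    by (intro Bochner_Integration.integral_cong) (auto simp: history_def)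
  finally show ?thesis .
qed

text \<open>Two probability measures that agree on measurable rectangles, an intersection-stable
  generator, are equal.\<close>

lemma joint_law:
  "distr P (pasts \<Otimes>\<^sub>M S) (\<lambda>\<omega>. (history \<omega>, X (Suc k) \<omega>)) = distr P pasts history \<bind> next_kernel"
  (is "?L = ?R")
proof -
  have Xk: "X (Suc k) \<in> P \<rightarrow>\<^sub>M S" using k by (intro X_meas) auto
  have pair: "(\<lambda>\<omega>. (history \<omega>, X (Suc k) \<omega>)) \<in> P \<rightarrow>\<^sub>M pasts \<Otimes>\<^sub>M S"
    using history_meas Xk by measurable
  have L: "prob_space ?L" by (rule P.prob_space_distr[OF pair])
  have "(\<lambda>_. distr P pasts history) \<in> P \<rightarrow>\<^sub>M prob_algebra pasts"
    using P.prob_space_distr[OF history_meas] by (auto simp: space_prob_algebra)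
  from measurable_bind_prob_space[OF this next_kernel_meas]
  have "?R \<in> space (prob_algebra (pasts \<Otimes>\<^sub>M S))" if "\<omega> \<in> space P" for \<omega>
    using measurable_space that by metis
  then have R: "prob_space ?R" "sets ?R = sets (pasts \<Otimes>\<^sub>M S)"
    using P.not_empty by (auto simp: space_prob_algebra)
  interpret L: prob_space ?L by fact
  interpret R: prob_space ?R by fact
  let ?E = "{a \<times> b | a b. a \<in> sets pasts \<and> b \<in> sets S}"
  show ?thesis
  proof (rule measure_eqI_generator_eq[OF Int_stable_pair_measure_generator[of pasts S]])
    show "?E \<subseteq> Pow (space pasts \<times> space S)"
      using sets.space_closed[of pasts] sets.space_closed[of S] by auto
    show "sets ?L = sigma_sets (space pasts \<times> space S) ?E"
      by (simp add: sets_pair_measure)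
    show "sets ?R = sigma_sets (space pasts \<times> space S) ?E"
      using R(2) by (simp add: sets_pair_measure)
    show "range (\<lambda>_::nat. space pasts \<times> space S) \<subseteq> ?E" by auto
    show "(\<Union>i::nat. space pasts \<times> space S) = space pasts \<times> space S" by simp
    show "emeasure ?L (space pasts \<times> space S) \<noteq> \<infinity>"
      unfolding infinity_ennreal_def by (rule L.emeasure_finite)
    fix D assume "D \<in> ?E"
    then obtain A B where D: "D = A \<times> B" and A: "A \<in> sets pasts" and B: "B \<in> sets S" by blast
    have AB: "A \<times> B \<in> sets (pasts \<Otimes>\<^sub>M S)" using A B by simp
    have ind: "indicator (A \<times> B) (u, y) = (indicator A u * indicator B y :: real)" for u y
      by (simp add: indicator_def)
    have "measure ?L (A \<times> B) = (\<integral>z. indicator (A \<times> B) z \<partial>?L)"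
      using AB by simp
    also have "\<dots> = (\<integral>\<omega>. indicator (A \<times> B) (history \<omega>, X (Suc k) \<omega>) \<partial>P)"
      by (rule integral_distr[OF pair]) (use AB in simp)
    also have "\<dots> = (\<integral>\<omega>. indicator A (history \<omega>) * measure (K k (X k \<omega>)) B \<partial>P)"
      unfolding ind by (rule markov_rectangle[OF A B])
    also have "\<dots> = (\<integral>\<omega>. (\<integral>y. indicator (A \<times> B) (history \<omega>, y) \<partial>K k (X k \<omega>)) \<partial>P)"
    proof (rule Bochner_Integration.integral_cong)
      fix \<omega> assume \<omega>: "\<omega> \<in> space P"
      have "K k (X k \<omega>) \<in> space (prob_algebra S)"
        using measurable_space[OF K[OF k]] measurable_space[OF X_meas \<omega>] k by auto
      then have "sets (K k (X k \<omega>)) = sets S" by (simp add: space_prob_algebra)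
      then show "indicator A (history \<omega>) * measure (K k (X k \<omega>)) B
         = (\<integral>y. indicator (A \<times> B) (history \<omega>, y) \<partial>K k (X k \<omega>))"
        unfolding ind using B sets_eq_imp_space_eq by (simp add: sets.Int_space_eq2)
    qed simp
    also have "\<dots> = (\<integral>z. indicator (A \<times> B) z \<partial>?R)"
      by (rule integral_next_kernel[symmetric])
        (rule bounded_measurableI[of _ _ 1], use AB in \<open>auto simp: indicator_def\<close>)
    also have "\<dots> = measure ?R (A \<times> B)"
      using AB R(2) by simp
    finally show "emeasure ?L D = emeasure ?R D"
      by (simp only: L.emeasure_eq_measure R.emeasure_eq_measure D)
  qed
qed

end

lemma markov_step:
  assumes k: "k < N" and h: "bounded_measurable paths h" "depends_on {1..Suc k} h"
  shows "(\<integral>\<omega>. h (trajectory \<omega>) \<partial>P) = (\<integral>\<omega>. E k h (trajectory \<omega>) \<partial>P)"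
proof -
  obtain \<omega>0 where \<omega>0: "\<omega>0 \<in> space P" using P.not_empty by blast
  let ?x = "trajectory \<omega>0"
  have x: "?x \<in> space paths" using trajectory_space[OF \<omega>0] .
  have Eh: "E k h (trajectory \<omega>) = (\<integral>y. h ((trajectory \<omega>)(Suc k := y)) \<partial>next_law k (trajectory \<omega>))"
    if "\<omega> \<in> space P" for \<omega>
    by (rule E_step_of_past[OF k trajectory_space[OF that] h])
  show ?thesis
  proof (cases "k = 0")
    case True
    \<comment> \<open>Here \<open>{1..Suc k}\<close> is \<open>{1}\<close>, so \<open>h\<close> sees
      only the first coordinate and the others can be frozen at those of \<open>?x\<close>.\<close>
    have "h (trajectory \<omega>) = h (?x(1 := X 1 \<omega>))" if \<omega>: "\<omega> \<in> space P" for \<omega>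
    proof (rule depends_onD[OF h(2) trajectory_space[OF \<omega>]])
      show "?x(1 := X 1 \<omega>) \<in> space paths"
        using upd_in_paths[OF k x] measurable_space[OF X_meas \<omega>] True N_pos by auto
    qed (use True N_pos in \<open>auto simp: trajectory_def\<close>)
    then have "(\<integral>\<omega>. h (trajectory \<omega>) \<partial>P) = (\<integral>\<omega>. h (?x(1 := X 1 \<omega>)) \<partial>P)"
      by (intro Bochner_Integration.integral_cong) auto
    also have "\<dots> = (\<integral>y. h (?x(1 := y)) \<partial>\<nu>)"
      unfolding initial_law
      by (rule integral_distr[symmetric, OF X_meas])
        (use N_pos k True measurable_compose[OF measurable_upd2[OF k x] bounded_measurableD[OF h(1)]] in auto)
    also have "\<dots> = E k h (trajectory \<omega>)" if \<omega>: "\<omega> \<in> space P" for \<omega>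
    proof -
      have "h ((trajectory \<omega>)(Suc k := y)) = h (?x(1 := y))" if "y \<in> space S" for y
        using True depends_onD[OF h(2) upd_in_paths[OF k trajectory_space[OF \<omega>] that] upd_in_paths[OF k x that]]
        by auto
      then show ?thesis
        unfolding Eh[OF \<omega>] using True next_law_prob(4)[OF k trajectory_space[OF \<omega>]]
        by (intro Bochner_Integration.integral_cong) (auto simp: next_law_def)
    qed
    finally have c: "\<And>\<omega>. \<omega> \<in> space P \<Longrightarrow> (\<integral>\<omega>. h (trajectory \<omega>) \<partial>P) = E k h (trajectory \<omega>)" .
    have "(\<integral>\<omega>. E k h (trajectory \<omega>) \<partial>P) = (\<integral>_. (\<integral>\<omega>. h (trajectory \<omega>) \<partial>P) \<partial>P)"
      using c by (intro Bochner_Integration.integral_cong) auto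
    then show ?thesis by (simp add: P.prob_space)
  next
    case False
    then have k': "k \<in> {1..<N}" using k by simp
    let ?pasts = "Pi\<^sub>M {1..k} (\<lambda>_. S)"
    \<comment> \<open>Coordinates after \<open>Suc k\<close> are filled in from the fixed path
      \<open>?x\<close>; since \<open>h\<close> does not see them, \<open>h\<close> becomes a
      function of the history and the next state.\<close>
    define merge where "merge z = (\<lambda>j\<in>{1..N}. if j = Suc k then snd z else if j \<le> k then fst z j else ?x j)"
      for z :: "(nat \<Rightarrow> 'a) \<times> 'a"
    have merge: "merge \<in> ?pasts \<Otimes>\<^sub>M S \<rightarrow>\<^sub>M paths"
      unfolding merge_def[abs_def] paths_def
    proof (rule measurable_restrict)
      fix j assume j: "j \<in> {1..N}"
      have xj: "?x j \<in> space S" using measurable_space[OF X_meas[OF j] \<omega>0] j by (simp add: trajectory_def)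
      have snd: "(\<lambda>z. snd z) \<in> ?pasts \<Otimes>\<^sub>M S \<rightarrow>\<^sub>M S" by (rule measurable_snd)
      have fst: "(\<lambda>z. fst z j) \<in> ?pasts \<Otimes>\<^sub>M S \<rightarrow>\<^sub>M S" if "j \<le> k"
        using that j by (intro measurable_compose[OF measurable_fst measurable_component_singleton]) auto
      show "(\<lambda>z. if j = Suc k then snd z else if j \<le> k then fst z j else ?x j) \<in> ?pasts \<Otimes>\<^sub>M S \<rightarrow>\<^sub>M S"
      proof (cases "j = Suc k")
        case True then show ?thesis using snd by simp
      next
        case False
        then show ?thesis using fst measurable_const[OF xj] by (cases "j \<le> k") simp_all
      qed
    qed
    have hm: "bounded_measurable (?pasts \<Otimes>\<^sub>M S) (\<lambda>z. h (merge z))"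
      by (rule bounded_measurable_comp[OF h(1) merge])
    have Xk: "X (Suc k) \<in> P \<rightarrow>\<^sub>M S" using k by (intro X_meas) auto
    have pair: "(\<lambda>\<omega>. (history k \<omega>, X (Suc k) \<omega>)) \<in> P \<rightarrow>\<^sub>M ?pasts \<Otimes>\<^sub>M S"
      using history_meas[OF k'] Xk by measurable
    have hist: "history k \<omega> \<in> space ?pasts" if "\<omega> \<in> space P" for \<omega>
      using measurable_space[OF history_meas[OF k'] that] .
    have hpath: "h ((trajectory \<omega>)(Suc k := y)) = h (merge (history k \<omega>, y))"
      if \<omega>: "\<omega> \<in> space P" and y: "y \<in> space S" for \<omega> y
    proof (rule depends_onD[OF h(2) upd_in_paths[OF k trajectory_space[OF \<omega>] y]])
      show "merge (history k \<omega>, y) \<in> space paths"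
        using measurable_space[OF merge] hist[OF \<omega>] y by (simp add: space_pair_measure)
    qed (use k in \<open>auto simp: merge_def trajectory_def history_def\<close>)
    have "(\<integral>\<omega>. h (trajectory \<omega>) \<partial>P) = (\<integral>\<omega>. h (merge (history k \<omega>, X (Suc k) \<omega>)) \<partial>P)"
    proof (rule Bochner_Integration.integral_cong)
      fix \<omega> assume \<omega>: "\<omega> \<in> space P"
      have "(trajectory \<omega>)(Suc k := X (Suc k) \<omega>) = trajectory \<omega>" using k by (auto simp: trajectory_def fun_eq_iff)
      then show "h (trajectory \<omega>) = h (merge (history k \<omega>, X (Suc k) \<omega>))"
        using hpath[OF \<omega> measurable_space[OF Xk \<omega>]] by simp
    qed simp
    also have "\<dots> = (\<integral>z. h (merge z) \<partial>distr P (?pasts \<Otimes>\<^sub>M S) (\<lambda>\<omega>. (history k \<omega>, X (Suc k) \<omega>)))"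
      by (rule integral_distr[OF pair bounded_measurableD[OF hm], symmetric])
    also have "\<dots> = (\<integral>\<omega>. (\<integral>y. h (merge (history k \<omega>, y)) \<partial>K k (X k \<omega>)) \<partial>P)"
      unfolding joint_law[OF k'] by (rule integral_next_kernel[OF k' hm])
    also have "\<dots> = (\<integral>\<omega>. E k h (trajectory \<omega>) \<partial>P)"
    proof (rule Bochner_Integration.integral_cong)
      fix \<omega> assume \<omega>: "\<omega> \<in> space P"
      have "next_law k (trajectory \<omega>) = K k (X k \<omega>)" using False k by (simp add: next_law_def trajectory_def)
      then show "(\<integral>y. h (merge (history k \<omega>, y)) \<partial>K k (X k \<omega>)) = E k h (trajectory \<omega>)"
        unfolding Eh[OF \<omega>] using hpath[OF \<omega>] next_law_prob(4)[OF k trajectory_space[OF \<omega>]]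
        by (intro Bochner_Integration.integral_cong) auto
    qed simp
    finally show ?thesis .
  qed
qed

section \<open>From one step to the law of the whole trajectory\<close>

lemma expectation_E:
  assumes H: "bounded_measurable paths H"
  shows "k \<le> N \<Longrightarrow> (\<integral>\<omega>. H (trajectory \<omega>) \<partial>P) = (\<integral>\<omega>. E k H (trajectory \<omega>) \<partial>P)"
proof (induction k rule: inc_induct)
  case base
  show ?case
    using trajectory_space E_terminal[OF _ H] by (intro Bochner_Integration.integral_cong) auto
next
  case (step k)
  have "(\<integral>\<omega>. E (Suc k) H (trajectory \<omega>) \<partial>P) = (\<integral>\<omega>. E k (E (Suc k) H) (trajectory \<omega>) \<partial>P)"
    by (rule markov_step[OF step.hyps(2)]) (use step H depends_on_E_all[OF H] in auto)
  also have "\<dots> = (\<integral>\<omega>. E k H (trajectory \<omega>) \<partial>P)"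
    using E_tower[OF H, of "Suc k" k] trajectory_space step.hyps by (intro Bochner_Integration.integral_cong) auto
  finally show ?case using step.IH by simp
qed

text \<open>\<open>E 0\<close> of an indicator depends on the coordinates in \<open>{1..0}\<close>,
  that is on none. Being constant, it equals its own expectation along the trajectory.\<close>

lemma path_law_eq_distr:
  assumes x: "x \<in> space paths"
  shows "path_law 0 x = distr P paths trajectory"
proof (rule measure_eqI)
  show sets: "sets (path_law 0 x) = sets (distr P paths trajectory)"
    using sets_Q[of 0 x] x by simp
  fix D assume "D \<in> sets (path_law 0 x)"
  then have D: "D \<in> sets paths" using sets by simp
  interpret Q: prob_space "path_law 0 x" using prob_space_Q x by simp
  interpret d: prob_space "distr P paths trajectory" by (rule P.prob_space_distr[OF trajectory_meas])
  let ?H = "indicator D :: (nat \<Rightarrow> 'a) \<Rightarrow> real"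
  have H: "bounded_measurable paths ?H"
    by (rule bounded_measurableI[of _ _ 1]) (use D in \<open>auto simp: indicator_def\<close>)
  have "measure (path_law 0 x) D = E 0 ?H x"
    using D sets by (simp add: E_def)
  also have "\<dots> = (\<integral>\<omega>. E 0 ?H x \<partial>P)" by (simp add: P.prob_space)
  also have "\<dots> = (\<integral>\<omega>. E 0 ?H (trajectory \<omega>) \<partial>P)"
    using depends_onD[OF depends_on_E_all[OF H, of 0] x trajectory_space]
    by (intro Bochner_Integration.integral_cong) auto
  also have "\<dots> = (\<integral>\<omega>. ?H (trajectory \<omega>) \<partial>P)" using expectation_E[OF H, of 0] by simp
  also have "\<dots> = (\<integral>z. ?H z \<partial>distr P paths trajectory)"
    by (rule integral_distr[OF trajectory_meas bounded_measurableD[OF H], symmetric])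
  also have "\<dots> = measure (distr P paths trajectory) D" using D by simp
  finally show "emeasure (path_law 0 x) D = emeasure (distr P paths trajectory) D"
    by (simp add: Q.emeasure_eq_measure d.emeasure_eq_measure)
qed

lemma cexp_0:
  fixes H :: "_ \<Rightarrow> 'b::{banach, second_countable_topology}"
  assumes "x \<in> space paths" "H \<in> borel_measurable paths"
  shows "cexp 0 H x = (\<integral>\<omega>. H (trajectory \<omega>) \<partial>P)"
  unfolding cexp_def path_law_eq_distr[OF assms(1)] by (rule integral_distr[OF trajectory_meas assms(2)])

end

subsection \<open>The central limit theorem\<close>

text \<open>A real supremum is an upper bound only for a family bounded above; here 1 is a
  bound.\<close>

lemma dobrushin_bound:
  assumes K: "markov_kernel S K" and xy: "x \<in> space S" "y \<in> space S" and B: "B \<in> sets S"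
  shows "\<bar>measure (K x) B - measure (K y) B\<bar> \<le> dobrushin_coeff S K"
proof -
  have pK: "prob_space (K u)" if "u \<in> space S" for u
    using measurable_space[OF K[unfolded markov_kernel_def] that] by (simp add: space_prob_algebra)
  have "\<bar>measure (K u) D - measure (K v) D\<bar> \<le> 1" if "u \<in> space S" "v \<in> space S" for u v D
    using prob_space.prob_le_1[OF pK[OF that(1)], of D] prob_space.prob_le_1[OF pK[OF that(2)], of D]
      measure_nonneg[of "K u" D] measure_nonneg[of "K v" D] by linarith
  then have "bdd_above ((\<lambda>(x1, x2, B). \<bar>measure (K x1) B - measure (K x2) B\<bar>) ` (space S \<times> space S \<times> sets S))"
    by (intro bdd_aboveI[of _ 1]) auto
  then show ?thesis
    unfolding dobrushin_coeff_def using cSUP_upper[of "(x, y, B)" "space S \<times> space S \<times> sets S"] xy B by fastforce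
qed

lemma min_ergodic_coeff_contraction:
  assumes K: "\<And>k. k \<in> {1..<n} \<Longrightarrow> markov_kernel S (K k)" and ne: "space S \<noteq> {}"
  shows "min_ergodic_coeff S K n \<le> 1"
    and "k \<in> {1..<n} \<Longrightarrow> x \<in> space S \<Longrightarrow> y \<in> space S \<Longrightarrow> B \<in> sets S \<Longrightarrow>
      \<bar>measure (K k x) B - measure (K k y) B\<bar> \<le> 1 - min_ergodic_coeff S K n"
proof -
  have le: "min_ergodic_coeff S K n \<le> ergodic_coeff S (K k)" if "k \<in> {1..<n}" for k
    using that by (auto simp: min_ergodic_coeff_def)
  show "min_ergodic_coeff S K n \<le> 1"
  proof (cases "n \<le> 1")
    case False
    then have k: "1 \<in> {1..<n}" by simp
    obtain x where x: "x \<in> space S" using ne by blast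
    \<comment> \<open>Equal states and the empty set contribute the value 0 to the supremum.\<close>
    have "0 \<le> dobrushin_coeff S (K 1)"
      using dobrushin_bound[OF K[OF k] x x sets.empty_sets] by simp
    then show ?thesis using le[OF k] by (simp add: ergodic_coeff_def)
  qed (simp add: min_ergodic_coeff_def)
  show "\<bar>measure (K k x) B - measure (K k y) B\<bar> \<le> 1 - min_ergodic_coeff S K n"
    if "k \<in> {1..<n}" "x \<in> space S" "y \<in> space S" "B \<in> sets S"
    using le[OF that(1)] dobrushin_bound[OF K[OF that(1)] that(2-4)] by (simp add: ergodic_coeff_def)
qed

lemma borel_measurable_window:
  assumes "markov_chain P S (n + m) K X" "f \<in> borel_measurable (Pi\<^sub>M {0..m} (\<lambda>_. S))" "i \<in> {1..n}"
  shows "window m X i \<in> P \<rightarrow>\<^sub>M Pi\<^sub>M {0..m} (\<lambda>_. S)" "(\<lambda>\<omega>. f (window m X i \<omega>)) \<in> borel_measurable P"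
proof -
  show win: "window m X i \<in> P \<rightarrow>\<^sub>M Pi\<^sub>M {0..m} (\<lambda>_. S)"
    unfolding window_def[abs_def] using assms(1,3)
    by (intro measurable_restrict) (auto simp: markov_chain_def)
  show "(\<lambda>\<omega>. f (window m X i \<omega>)) \<in> borel_measurable P"
    by (rule measurable_compose[OF win assms(2)])
qed

lemma borel_measurable_row_sum:
  assumes "markov_chain P S (n + m) K X" "\<And>i. i \<in> {1..n} \<Longrightarrow> f i \<in> borel_measurable (Pi\<^sub>M {0..m} (\<lambda>_. S))"
  shows "row_sum m n f X \<in> borel_measurable P"
  unfolding row_sum_def[abs_def]
  by (intro borel_measurable_sum borel_measurable_window(2)[OF assms(1)] assms(2))

text \<open>Centring each summand at its own mean and dividing by the standard deviation gives a
  \<open>centered_row\<close> whose \<open>tail 0\<close> along the trajectory is the normalized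
  sum. As \<open>path_law 0\<close> is the law of the trajectory whatever its argument,
  \<open>cexp 0\<close> is the plain expectation.\<close>

lemma row_estimate:
  fixes S :: "'a measure" and P :: "'w measure" and n m :: nat and C t :: real
    and K :: "nat \<Rightarrow> 'a \<Rightarrow> 'a measure" and X :: "nat \<Rightarrow> 'w \<Rightarrow> 'a" and f :: "nat \<Rightarrow> (nat \<Rightarrow> 'a) \<Rightarrow> real"
  defines "R \<equiv> row_sum m n f X"
  defines "V \<equiv> prob_space.variance P R"
  defines "\<alpha> \<equiv> min_ergodic_coeff S K n"
  defines "e \<equiv> 5 * (m + 1) * ((2 * C / sqrt V) / \<alpha>)"
  defines "q \<equiv> \<bar>t\<bar> * e + 3 / 2 * t\<^sup>2 * e\<^sup>2"
  assumes n: "1 \<le> n" and chain: "markov_chain P S (n + m) K X"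
    and f_meas: "\<And>i. i \<in> {1..n} \<Longrightarrow> f i \<in> borel_measurable (Pi\<^sub>M {0..m} (\<lambda>_. S))"
    and f_bound: "\<And>i w. i \<in> {1..n} \<Longrightarrow> w \<in> space (Pi\<^sub>M {0..m} (\<lambda>_. S)) \<Longrightarrow> \<bar>f i w\<bar> \<le> C"
    and \<alpha>_pos: "0 < \<alpha>" and V_pos: "0 < V" and q: "q \<le> 1"
  shows "0 < e"
    and "norm (char (distr P borel (\<lambda>\<omega>. (R \<omega> - prob_space.expectation P R) / sqrt V)) t - of_real (exp (- t\<^sup>2 / 2)))
    \<le> (\<bar>t\<bar> ^ 3 * e / 4 + 4 * q * t\<^sup>2) + (\<bar>t\<bar> ^ 3 / (4 * e) + t ^ 4 / 8 + q * t ^ 4) * (3 * e\<^sup>2)"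
proof -
  interpret prob_space P using chain by (simp add: markov_chain_def)
  let ?W = "Pi\<^sub>M {0..m} (\<lambda>_. S)"
  have X: "X i \<in> P \<rightarrow>\<^sub>M S" if "i \<in> {1..n + m}" for i
    using chain that by (simp add: markov_chain_def)
  have K: "markov_kernel S (K k)" if "k \<in> {1..<n + m}" for k
    using chain that by (simp add: markov_chain_def)
  have X1: "X 1 \<in> P \<rightarrow>\<^sub>M S" using n by (intro X) auto
  have ne: "space S \<noteq> {}" using not_empty measurable_space[OF X1] by blast
  have win: "window m X j \<in> P \<rightarrow>\<^sub>M ?W" if "j \<in> {1..n}" for j
    by (rule borel_measurable_window(1)[OF chain f_meas[OF that] that])
  have winf: "(\<lambda>\<omega>. f j (window m X j \<omega>)) \<in> borel_measurable P" if "j \<in> {1..n}" for j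
    by (rule borel_measurable_window(2)[OF chain f_meas[OF that] that])
  have winb: "\<bar>f j (window m X j \<omega>)\<bar> \<le> C" if "j \<in> {1..n}" "\<omega> \<in> space P" for j \<omega>
    using f_bound[OF that(1) measurable_space[OF win[OF that(1)] that(2)]] .
  have intf: "integrable P (\<lambda>\<omega>. f j (window m X j \<omega>))" if "j \<in> {1..n}" for j
    using winf[OF that] winb[OF that] by (intro integrable_const_bound[of _ C]) auto
  have R_meas: "R \<in> borel_measurable P"
    unfolding R_def by (rule borel_measurable_row_sum[OF chain f_meas])
  define \<mu> where "\<mu> j = expectation (\<lambda>\<omega>. f j (window m X j \<omega>))" for j
  have ER: "expectation R = (\<Sum>j=1..n. \<mu> j)"
    unfolding R_def row_sum_def[abs_def] \<mu>_def using intf by (intro Bochner_Integration.integral_sum) auto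
  \<comment> \<open>If \<open>C\<close> were not positive, all summands and hence the variance would
    vanish. Positivity matters because \<open>e\<close> occurs in a denominator.\<close>
  have C: "0 < C"
  proof (rule ccontr)
    assume "\<not> 0 < C"
    then have "f j (window m X j \<omega>) = 0" if "j \<in> {1..n}" "\<omega> \<in> space P" for j \<omega>
      using winb[OF that] by linarith
    then have R0: "R \<omega> = 0" if "\<omega> \<in> space P" for \<omega> using that by (simp add: R_def row_sum_def)
    then have "expectation R = 0" by (simp cong: Bochner_Integration.integral_cong)
    then have "V = 0" unfolding V_def using R0 by (simp cong: Bochner_Integration.integral_cong)
    then show False using V_pos by simp
  qed
  \<comment> \<open>The 2 pays for centring: a summand and its mean are each at most
    \<open>C\<close> in absolute value.\<close>
  define c where "c = 2 * C / sqrt V"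
  have c: "0 < c" using C V_pos by (simp add: c_def)
  show e_pos: "0 < e"
    unfolding e_def c_def[symmetric] using c \<alpha>_pos by (intro mult_pos_pos divide_pos_pos) auto
  define Z where "Z j x = (f j (\<lambda>i\<in>{0..m}. x (j + i)) - \<mu> j) / sqrt V" for j and x :: "nat \<Rightarrow> 'a"
  interpret chain: realized_chain S "n + m" "distr P S (X 1)" K P X
  proof
    show "distr P S (X 1) \<in> space (prob_algebra S)"
      using prob_space_distr[OF X1] by (simp add: space_prob_algebra)
    show "K k \<in> S \<rightarrow>\<^sub>M prob_algebra S" if "k \<in> {1..<n + m}" for k
      using K[OF that] by (simp add: markov_kernel_def)
  qed (use chain n in auto)
  have shift: "(\<lambda>x. \<lambda>i\<in>{0..m}. x (j + i)) \<in> chain.paths \<rightarrow>\<^sub>M ?W" if "j \<in> {1..n}" for j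
    unfolding chain.paths_def using that by (intro measurable_restrict measurable_component_singleton) auto
  have Z_meas: "Z j \<in> borel_measurable chain.paths" if "j \<in> {1..n}" for j
  proof -
    have [measurable]: "(\<lambda>x. f j (\<lambda>i\<in>{0..m}. x (j + i))) \<in> borel_measurable chain.paths"
      by (rule measurable_compose[OF shift[OF that] f_meas[OF that]])
    show ?thesis unfolding Z_def[abs_def] by measurable
  qed
  have Z_traj: "Z j (chain.trajectory \<omega>) = (f j (window m X j \<omega>) - \<mu> j) / sqrt V" if "j \<in> {1..n}" for j \<omega>
  proof -
    have "(\<lambda>i\<in>{0..m}. chain.trajectory \<omega> (j + i)) = window m X j \<omega>"
      using that by (auto simp: chain.trajectory_def window_def fun_eq_iff)
    then show ?thesis by (simp add: Z_def)
  qed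
  have \<mu>_bound: "\<bar>\<mu> j\<bar> \<le> C" if "j \<in> {1..n}" for j
    using integral_norm_le_const[of "\<lambda>\<omega>. f j (window m X j \<omega>)" C] winb[OF that] by (simp add: \<mu>_def)
  interpret row: centered_row S "n + m" "distr P S (X 1)" K n m \<alpha> c Z
  proof
    show "\<alpha> \<le> 1" unfolding \<alpha>_def by (rule min_ergodic_coeff_contraction(1)[OF K ne]) auto
    show "\<bar>(\<integral>y. g y \<partial>K k u) - (\<integral>y. g y \<partial>K k u')\<bar> \<le> (1 - \<alpha>) * b"
      if k: "k \<in> {1..<n}" and u: "u \<in> space S" "u' \<in> space S" and g: "g \<in> borel_measurable S"
        "\<And>y y'. y \<in> space S \<Longrightarrow> y' \<in> space S \<Longrightarrow> \<bar>g y - g y'\<bar> \<le> b" for k u u' g b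
    proof (rule integral_difference_le_oscillation)
      have "K k \<in> S \<rightarrow>\<^sub>M prob_algebra S" using K[of k] k by (simp add: markov_kernel_def)
      from measurable_space[OF this u(1)] measurable_space[OF this u(2)]
      show "prob_space (K k u)" "sets (K k u) = sets S" "prob_space (K k u')" "sets (K k u') = sets S"
        by (auto simp: space_prob_algebra)
      show "\<bar>measure (K k u) B - measure (K k u') B\<bar> \<le> 1 - \<alpha>" if "B \<in> sets S" for B
        unfolding \<alpha>_def by (rule min_ergodic_coeff_contraction(2)[OF K ne k u that]) auto
    qed (use g in auto)
    show "\<bar>Z j x\<bar> \<le> c" if j: "j \<in> {1..n}" and x: "x \<in> space chain.paths" for j x
    proof -
      have "\<bar>f j (\<lambda>i\<in>{0..m}. x (j + i)) - \<mu> j\<bar> \<le> 2 * C"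
        using f_bound[OF j measurable_space[OF shift[OF j] x]] \<mu>_bound[OF j] by linarith
      then show ?thesis using V_pos by (simp add: Z_def c_def divide_right_mono)
    qed
    show "chain.depends_on {j..j + m} (Z j)" for j
    proof -
      have "(\<lambda>i\<in>{0..m}. x (j + i)) = (\<lambda>i\<in>{0..m}. y (j + i))" if "\<forall>i\<in>{j..j + m}. x i = y i" for x y :: "nat \<Rightarrow> 'a"
        using that by (auto simp: fun_eq_iff restrict_def)
      then show ?thesis unfolding chain.depends_on_def Z_def by metis
    qed
    show "chain.E 0 (Z j) x = 0" if j: "j \<in> {1..n}" and x: "x \<in> space chain.paths" for j x
    proof -
      have "chain.E 0 (Z j) x = expectation (\<lambda>\<omega>. (f j (window m X j \<omega>) - \<mu> j) / sqrt V)"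
        unfolding chain.E_eq_cexp chain.cexp_0[OF x Z_meas[OF j]] using Z_traj[OF j] by simp
      also have "\<dots> = 0" using intf[OF j] by (simp add: \<mu>_def prob_space)
      finally show ?thesis .
    qed
  qed (use \<alpha>_pos c Z_meas in auto)
  have tail: "row.tail 0 (chain.trajectory \<omega>) = (R \<omega> - expectation R) / sqrt V" for \<omega>
  proof -
    have "row.tail 0 (chain.trajectory \<omega>) = (\<Sum>j=1..n. (f j (window m X j \<omega>) - \<mu> j) / sqrt V)"
      unfolding row.tail_def using Z_traj by (intro sum.cong) auto
    then show ?thesis
      unfolding ER by (simp add: R_def row_sum_def sum_subtractf flip: sum_divide_distrib)
  qed
  have tail_meas: "row.tail 0 \<in> borel_measurable chain.paths"
    using row.bounded_measurable_tail by (rule bounded_measurableD)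
  obtain \<omega>0 where \<omega>0: "\<omega>0 \<in> space P" using not_empty by blast
  let ?x = "chain.trajectory \<omega>0"
  have x: "?x \<in> space chain.paths" using chain.trajectory_space[OF \<omega>0] .
  have var: "chain.E 0 (\<lambda>y. (row.tail 0 y)\<^sup>2) x = 1" if x: "x \<in> space chain.paths" for x
  proof -
    have "chain.E 0 (\<lambda>y. (row.tail 0 y)\<^sup>2) x = expectation (\<lambda>\<omega>. ((R \<omega> - expectation R) / sqrt V)\<^sup>2)"
      unfolding chain.E_eq_cexp chain.cexp_0[OF x borel_measurable_power[OF tail_meas]] tail ..
    also have "\<dots> = expectation (\<lambda>\<omega>. (R \<omega> - expectation R)\<^sup>2 / V)"
      using V_pos by (simp add: power_divide)
    also have "\<dots> = V / V" by (simp add: V_def)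
    finally show ?thesis using V_pos by simp
  qed
  have meas: "(\<lambda>\<omega>. (R \<omega> - expectation R) / sqrt V) \<in> borel_measurable P"
    using R_meas by measurable
  have char: "char (distr P borel (\<lambda>\<omega>. (R \<omega> - expectation R) / sqrt V)) t
      = chain.cexp 0 (\<lambda>y. exp (\<i> * of_real (t * row.tail 0 y))) ?x"
  proof -
    have "(\<lambda>y. exp (\<i> * complex_of_real (t * row.tail 0 y))) \<in> borel_measurable chain.paths"
      using tail_meas by measurable
    from chain.cexp_0[OF x this]
    have "chain.cexp 0 (\<lambda>y. exp (\<i> * of_real (t * row.tail 0 y))) ?x
        = (\<integral>\<omega>. iexp (t * ((R \<omega> - expectation R) / sqrt V)) \<partial>P)"
      unfolding tail .
    also have "\<dots> = char (distr P borel (\<lambda>\<omega>. (R \<omega> - expectation R) / sqrt V)) t"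
      unfolding char_def by (rule integral_distr[OF meas, symmetric]) measurable
    finally show ?thesis ..
  qed
  show "norm (char (distr P borel (\<lambda>\<omega>. (R \<omega> - expectation R) / sqrt V)) t - of_real (exp (- t\<^sup>2 / 2)))
    \<le> (\<bar>t\<bar> ^ 3 * e / 4 + 4 * q * t\<^sup>2) + (\<bar>t\<bar> ^ 3 / (4 * e) + t ^ 4 / 8 + q * t ^ 4) * (3 * e\<^sup>2)"
    unfolding char q_def e_def c_def[symmetric]
    by (rule row.row_char_near_gaussian[OF x _ var]) (use q in \<open>simp_all add: q_def e_def c_def\<close>)
qed

theorem theorem1:
  fixes E :: "'a::polish_space set"
    and m :: nat
    and P :: "nat \<Rightarrow> 'w measure"
    and K :: "nat \<Rightarrow> nat \<Rightarrow> 'a \<Rightarrow> 'a measure"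
    and X :: "nat \<Rightarrow> nat \<Rightarrow> 'w \<Rightarrow> 'a"
    and f :: "nat \<Rightarrow> nat \<Rightarrow> (nat \<Rightarrow> 'a) \<Rightarrow> real"
    and C :: "nat \<Rightarrow> real"
  defines "\<X> \<equiv> restrict_space borel E"
  defines "S \<equiv> (\<lambda>n. row_sum m n (f n) (X n))"
  defines "\<alpha> \<equiv> (\<lambda>n. min_ergodic_coeff \<X> (K n) n)"
  defines "\<mu> \<equiv> (\<lambda>n. prob_space.expectation (P n) (S n))"
  defines "V \<equiv> (\<lambda>n. prob_space.variance (P n) (S n))"
  assumes "E \<in> sets borel"
    and "\<And>n. n \<ge> 1 \<Longrightarrow> markov_chain (P n) \<X> (n + m) (K n) (X n)"
    and "\<And>n i. n \<ge> 1 \<Longrightarrow> i \<in> {1..n} \<Longrightarrow> f n i \<in> borel_measurable (Pi\<^sub>M {0..m} (\<lambda>_. \<X>))"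
    and "\<And>n. n \<ge> 1 \<Longrightarrow>
           (MAX i\<in>{1..n}. sup_norm_on (space (Pi\<^sub>M {0..m} (\<lambda>_. \<X>))) (f n i)) \<le> ereal (C n)"
    and "\<forall>\<^sub>F n in sequentially. \<alpha> n > 0 \<and> V n > 0"
    and "(\<lambda>n. (C n)\<^sup>2 * \<alpha> n powi (-2) / V n) \<longlonglongrightarrow> 0"
  shows "weak_conv_m (\<lambda>n. distr (P n) borel (\<lambda>\<omega>. (S n \<omega> - \<mu> n) / sqrt (V n)))
           std_normal_distribution"
proof -
  note chain = assms(7) and f_meas = assms(8) and f_max = assms(9) and pos = assms(10) and lim = assms(11)
  have f_bound: "\<bar>f n i w\<bar> \<le> C n"
    if n: "n \<ge> 1" and i: "i \<in> {1..n}" and w: "w \<in> space (Pi\<^sub>M {0..m} (\<lambda>_. \<X>))" for n i w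
  proof -
    have "ereal \<bar>f n i w\<bar> \<le> sup_norm_on (space (Pi\<^sub>M {0..m} (\<lambda>_. \<X>))) (f n i)"
      unfolding sup_norm_on_def by (rule SUP_upper[OF w])
    also have "\<dots> \<le> (MAX i\<in>{1..n}. sup_norm_on (space (Pi\<^sub>M {0..m} (\<lambda>_. \<X>))) (f n i))"
      using i by (intro Max_ge) auto
    also have "\<dots> \<le> ereal (C n)" by (rule f_max[OF n])
    finally show ?thesis by simp
  qed
  define D where "D n = distr (P n) borel (\<lambda>\<omega>. (S n \<omega> - \<mu> n) / sqrt (V n))" for n
  define e where "e n = 5 * (m + 1) * ((2 * C n / sqrt (V n)) / \<alpha> n)" for n
  \<comment> \<open>The right-hand side of \<open>row_estimate\<close> with the factor
    \<open>3 * e^2\<close> multiplied out. This cancels \<open>1 / e\<close> and leaves a polynomial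
    in \<open>e\<close> that vanishes at 0.\<close>
  define bound where "bound t e = (\<bar>t\<bar> ^ 3 * e / 4 + 4 * (\<bar>t\<bar> * e + 3 / 2 * t\<^sup>2 * e\<^sup>2) * t\<^sup>2)
      + (3 * \<bar>t\<bar> ^ 3 * e / 4 + 3 * t ^ 4 * e\<^sup>2 / 8 + 3 * (\<bar>t\<bar> * e + 3 / 2 * t\<^sup>2 * e\<^sup>2) * t ^ 4 * e\<^sup>2)" for t e :: real
  have S_meas: "S n \<in> borel_measurable (P n)" if n: "n \<ge> 1" for n
    unfolding S_def by (rule borel_measurable_row_sum[OF chain[OF n] f_meas[OF n]])
  \<comment> \<open>Up to the factor \<open>10 * (m + 1)\<close>, with 10 as 5 times the 2 from
    centring, the absolute value of \<open>e n\<close> is the square root of the quotient in the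
    hypothesis.\<close>
  have e0: "e \<longlonglongrightarrow> 0"
  proof (rule tendsto_norm_zero_cancel, rule Lim_transform_eventually)
    have "(\<lambda>n. 10 * (m + 1) * sqrt ((C n)\<^sup>2 * \<alpha> n powi (-2) / V n)) \<longlonglongrightarrow> 10 * (m + 1) * sqrt 0"
      by (intro tendsto_mult tendsto_const tendsto_real_sqrt lim)
    then show "(\<lambda>n. 10 * (m + 1) * sqrt ((C n)\<^sup>2 * \<alpha> n powi (-2) / V n)) \<longlonglongrightarrow> 0" by simp
    show "\<forall>\<^sub>F n in sequentially. 10 * (m + 1) * sqrt ((C n)\<^sup>2 * \<alpha> n powi (-2) / V n) = norm (e n)"
      using pos
    proof eventually_elim
      case (elim n)
      have "(C n)\<^sup>2 * \<alpha> n powi (-2) / V n = (C n / (sqrt (V n) * \<alpha> n))\<^sup>2"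
        using elim by (simp add: power_int_minus power_divide power_mult_distrib field_simps)
      then show ?case using elim by (simp add: e_def abs_mult real_sqrt_abs)
    qed
  qed
  have key: "\<forall>\<^sub>F n in sequentially. norm (char (D n) t - of_real (exp (- t\<^sup>2 / 2))) \<le> bound t (e n)" for t
  proof -
    have "(\<lambda>n. \<bar>t\<bar> * e n + 3 / 2 * t\<^sup>2 * (e n)\<^sup>2) \<longlonglongrightarrow> \<bar>t\<bar> * 0 + 3 / 2 * t\<^sup>2 * 0\<^sup>2"
      by (intro tendsto_intros e0)
    then have "\<forall>\<^sub>F n in sequentially. \<bar>t\<bar> * e n + 3 / 2 * t\<^sup>2 * (e n)\<^sup>2 < 1"
      by (rule order_tendstoD) simp
    then show ?thesis
      using pos eventually_ge_at_top[of 1]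
    proof eventually_elim
      case (elim n)
      have q: "\<bar>t\<bar> * e n + 3 / 2 * t\<^sup>2 * (e n)\<^sup>2 \<le> 1" using elim(1) by simp
      note row = row_estimate[where t=t and f="f n", OF elim(3) chain[OF elim(3)] f_meas[OF elim(3)] f_bound[OF elim(3)]]
      \<comment> \<open>Cancelling \<open>e n\<close> against the denominator requires it to be
        nonzero.\<close>
      have pos': "0 < e n"
        using row(1) elim(2) q unfolding e_def V_def \<alpha>_def S_def by blast
      have "norm (char (D n) t - of_real (exp (- t\<^sup>2 / 2)))
        \<le> (\<bar>t\<bar> ^ 3 * e n / 4 + 4 * (\<bar>t\<bar> * e n + 3 / 2 * t\<^sup>2 * (e n)\<^sup>2) * t\<^sup>2)
        + (\<bar>t\<bar> ^ 3 / (4 * e n) + t ^ 4 / 8 + (\<bar>t\<bar> * e n + 3 / 2 * t\<^sup>2 * (e n)\<^sup>2) * t ^ 4) * (3 * (e n)\<^sup>2)"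
        using row(2) elim(2) q unfolding D_def e_def V_def \<alpha>_def \<mu>_def S_def by blast
      also have "\<dots> = bound t (e n)"
        unfolding bound_def using pos' by (simp add: field_simps power2_eq_square)
      finally show ?case .
    qed
  qed
  have char_lim: "(\<lambda>n. char (D n) t) \<longlonglongrightarrow> char std_normal_distribution t" for t
  proof -
    have "(\<lambda>n. bound t (e n)) \<longlonglongrightarrow> bound t 0"
      unfolding bound_def by (intro tendsto_intros e0) auto
    then have "(\<lambda>n. bound t (e n)) \<longlonglongrightarrow> 0" by (simp add: bound_def)
    then have "(\<lambda>n. char (D n) t - of_real (exp (- t\<^sup>2 / 2))) \<longlonglongrightarrow> 0"
      by (rule Lim_null_comparison[OF key])
    then show ?thesis
      unfolding char_std_normal_distribution by (simp add: LIM_zero_iff)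
  qed
  text \<open>The hypotheses say nothing about \<open>P 0\<close>, hence the shift.\<close>
  have "weak_conv_m (\<lambda>n. D (Suc n)) std_normal_distribution"
  proof (rule levy_continuity)
    show "real_distribution (D (Suc n))" for n
    proof -
      interpret prob_space "P (Suc n)" using chain[of "Suc n"] by (simp add: markov_chain_def)
      have [measurable]: "S (Suc n) \<in> borel_measurable (P (Suc n))" by (rule S_meas) simp
      show ?thesis unfolding D_def by (rule real_distribution_distr) measurable
    qed
    show "(\<lambda>n. char (D (Suc n)) t) \<longlonglongrightarrow> char std_normal_distribution t" for t
      by (rule LIMSEQ_Suc[OF char_lim])
  qed (rule real_dist_normal_dist)
  then show ?thesis
    unfolding weak_conv_m_def weak_conv_def D_def by (auto intro: LIMSEQ_imp_Suc)
qed

end
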